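(* Let $\mu$ be a Borel measure on $\mathbb{R}$ with $\int_{\mathbb{R}}(1+|t|)^{-1}\,d\mu(t)<\infty$, let $A=M_t$ be multiplication by the independent variable in $L^2(\mu)$, let $\varphi\equiv\mathbf 1$, let $\alpha\in\mathbb{R}$ and let $A_\alpha=A+\alpha(\,\cdot\,,\varphi)\varphi$ be the (form bounded) rank one perturbation. Let $\mu_\alpha$ be the spectral measure of $A_\alpha$ corresponding to $\varphi$. Then the spectral representation $V_\alpha:L^2(\mu)\to L^2(\mu_\alpha)$ of $A_\alpha$ is given by $$V_\alpha f(s)=f(s)-\alpha\int_{\mathbb{R}}\frac{f(s)-f(t)}{s-t}\,d\mu(t)\qquad(\text{for }\mu_\alpha\text{-a.e. }s)$$ for all compactly supported $C^1$ functions $f$ on $\mathbb{R}$.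
   Context: All $L^2$ spaces are complex, with $(f,g)_{L^2(\mu)}=\int f\overline g\,d\mu$. $A=M_t$, $(M_tf)(t)=tf(t)$, has its maximal domain in $L^2(\mu)$. The condition $\int(1+|t|)^{-1}d\mu<\infty$ means that $\varphi\equiv\mathbf 1$ belongs to $\mathcal H_{-1}(A)=L^2((1+|t|)^{-1}d\mu)$; $\varphi$ need not lie in $L^2(\mu)$. For $\lambda\in\mathbb{C}\setminus\mathbb{R}$ put $F(\lambda)=((A-\lambda)^{-1}\varphi,\varphi)=\int\frac{d\mu(t)}{t-\lambda}$. For $\alpha\in\mathbb{R}$, $A_\alpha=A+\alpha(\cdot,\varphi)\varphi$ denotes the self-adjoint operator on $L^2(\mu)$ whose resolvent is $$(A_\alpha-\lambda)^{-1}f=(A-\lambda)^{-1}f-\frac{\alpha\,((A-\lambda)^{-1}f,\varphi)}{1+\alpha F(\lambda)}(A-\lambda)^{-1}\varphi,\qquad f\in L^2(\mu),\ \lambda\in\mathbb{C}\setminus\mathbb{R},$$ where $((A-\lambda)^{-1}f,\varphi)=\int\frac{f(t)}{t-\lambda}d\mu(t)$ and $(A-\lambda)^{-1}\varphi$ is the function $t\mapsto (t-\lambda)^{-1}$ (if $\varphi\in L^2(\mu)$ this is the usual rank one perturbation). The resolvent formula is also used for $f=\varphi$, giving $(A_\alpha-\lambda)^{-1}\varphi=(1+\alpha F(\lambda))^{-1}(t-\lambda)^{-1}\in L^2(\mu)$; $\varphi$ is cyclic for $A_\alpha$, i.e. the span of these vectors is dense. $\mu_\alpha$ is the spectral measure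 of $A_\alpha$ corresponding to $\varphi$: the unique Borel measure with $\int\frac{d\mu_\alpha(s)}{s-\lambda}=((A_\alpha-\lambda)^{-1}\varphi,\varphi)$ for all $\lambda\in\mathbb{C}\setminus\mathbb{R}$. The spectral representation $V_\alpha:L^2(\mu)\to L^2(\mu_\alpha)$ is the unitary operator with $V_\alpha A_\alpha=M_sV_\alpha$ ($M_s$ being multiplication by the independent variable $s$ in $L^2(\mu_\alpha)$) under which $\varphi$ is represented by the function $\mathbf 1$, i.e. $V_\alpha(A_\alpha-\lambda)^{-1}\varphi=(s-\lambda)^{-1}$ for all $\lambda\in\mathbb{C}\setminus\mathbb{R}$. For $f\in C^1$, the quotient $\frac{f(s)-f(t)}{s-t}$ is extended by continuity to $t=s$ by the value $f'(s)$. *)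

theory Defs
  imports "HOL-Analysis.Analysis"
begin

section \<open>Complex L2 spaces\<close>

text \<open>
  Elements of $L^2(M)$ are handled through representatives: square integrable measurable functions,
  with equality almost everywhere stated explicitly wherever two elements are compared.
\<close>

definition L2 :: "'a measure \<Rightarrow> ('a \<Rightarrow> complex) set" where
  "L2 M = {f \<in> borel_measurable M. integrable M (\<lambda>x. (cmod (f x))\<^sup>2)}"

definition L2_inner :: "'a measure \<Rightarrow> ('a \<Rightarrow> complex) \<Rightarrow> ('a \<Rightarrow> complex) \<Rightarrow> complex" where
  "L2_inner M f g = (LINT x|M. f x * cnj (g x))"


section \<open>Unbounded operators, as graphs\<close>

text \<open>
  A (possibly unbounded) linear operator in $L^2(M)$ is given by its graph, a set of pairs of
  representatives which is saturated with respect to almost everywhere equality.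
\<close>

definition L2_operator ::
  "'a measure \<Rightarrow> (('a \<Rightarrow> complex) \<times> ('a \<Rightarrow> complex)) set \<Rightarrow> bool" where
  "L2_operator M G \<longleftrightarrow>
     G \<subseteq> L2 M \<times> L2 M \<and>
     (\<forall>f g f' g'. (f, g) \<in> G \<longrightarrow> f' \<in> L2 M \<longrightarrow> g' \<in> L2 M \<longrightarrow>
        (AE x in M. f' x = f x) \<longrightarrow> (AE x in M. g' x = g x) \<longrightarrow> (f', g') \<in> G) \<and>
     (\<forall>f g g'. (f, g) \<in> G \<longrightarrow> (f, g') \<in> G \<longrightarrow> (AE x in M. g x = g' x)) \<and>
     (\<lambda>_. 0, \<lambda>_. 0) \<in> G \<and>
     (\<forall>f g f' g'. (f, g) \<in> G \<longrightarrow> (f', g') \<in> G \<longrightarrow> (\<lambda>x. f x + f' x, \<lambda>x. g x + g' x) \<in> G) \<and>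
     (\<forall>c f g. (f, g) \<in> G \<longrightarrow> (\<lambda>x. c * f x, \<lambda>x. c * g x) \<in> G)"

definition L2_densely_defined ::
  "'a measure \<Rightarrow> (('a \<Rightarrow> complex) \<times> ('a \<Rightarrow> complex)) set \<Rightarrow> bool" where
  "L2_densely_defined M G \<longleftrightarrow>
     (\<forall>f \<in> L2 M. \<forall>e > 0. \<exists>(g, h) \<in> G. (LINT x|M. (cmod (f x - g x))\<^sup>2) < e)"

definition L2_adjoint ::
  "'a measure \<Rightarrow> (('a \<Rightarrow> complex) \<times> ('a \<Rightarrow> complex)) set
     \<Rightarrow> (('a \<Rightarrow> complex) \<times> ('a \<Rightarrow> complex)) set" where
  "L2_adjoint M G =
     {(u, v). u \<in> L2 M \<and> v \<in> L2 M \<and> (\<forall>(f, g) \<in> G. L2_inner M g u = L2_inner M f v)}"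

definition L2_self_adjoint ::
  "'a measure \<Rightarrow> (('a \<Rightarrow> complex) \<times> ('a \<Rightarrow> complex)) set \<Rightarrow> bool" where
  "L2_self_adjoint M G \<longleftrightarrow> L2_operator M G \<and> L2_densely_defined M G \<and> L2_adjoint M G = G"

text \<open>
  The inverse of $G - z$, as a graph: $(f, h)$ belongs to it iff $(G - z) h = f$, that is,
  $G h = f + z h$.
\<close>

definition L2_resolvent ::
  "'a measure \<Rightarrow> (('a \<Rightarrow> complex) \<times> ('a \<Rightarrow> complex)) set \<Rightarrow> complex
     \<Rightarrow> (('a \<Rightarrow> complex) \<times> ('a \<Rightarrow> complex)) set" where
  "L2_resolvent M G z =
     {(f, h). f \<in> L2 M \<and> h \<in> L2 M \<and> (h, \<lambda>x. f x + z * h x) \<in> G}"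

definition L2_unitary ::
  "'a measure \<Rightarrow> 'b measure \<Rightarrow> (('a \<Rightarrow> complex) \<Rightarrow> ('b \<Rightarrow> complex)) \<Rightarrow> bool" where
  "L2_unitary M N V \<longleftrightarrow>
     (\<forall>f \<in> L2 M. V f \<in> L2 N) \<and>
     (\<forall>f \<in> L2 M. \<forall>g \<in> L2 M. (AE x in M. f x = g x) \<longrightarrow> (AE y in N. V f y = V g y)) \<and>
     (\<forall>f \<in> L2 M. \<forall>g \<in> L2 M. AE y in N. V (\<lambda>x. f x + g x) y = V f y + V g y) \<and>
     (\<forall>c. \<forall>f \<in> L2 M. AE y in N. V (\<lambda>x. c * f x) y = c * V f y) \<and>
     (\<forall>f \<in> L2 M. \<forall>g \<in> L2 M. L2_inner N (V f) (V g) = L2_inner M f g) \<and>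
     (\<forall>k \<in> L2 N. \<exists>f \<in> L2 M. AE y in N. V f y = k y)"


section \<open>Multiplication by the independent variable and its rank one perturbations\<close>

definition mult_op :: "real measure \<Rightarrow> ((real \<Rightarrow> complex) \<times> (real \<Rightarrow> complex)) set" where
  "mult_op M = {(f, g). f \<in> L2 M \<and> g \<in> L2 M \<and> (AE t in M. g t = of_real t * f t)}"

text \<open>
  The resolvent of \<open>mult_op M\<close> as a function on representatives (see \<open>resolvent_mult_op\<close> below).
  It is also applied to the constant function 1, which need not lie in $L^2(M)$.
\<close>

definition mult_resolvent :: "complex \<Rightarrow> (real \<Rightarrow> complex) \<Rightarrow> real \<Rightarrow> complex" where
  "mult_resolvent z f t = f t / (of_real t - z)"

abbreviation phi :: "real \<Rightarrow> complex" where
  "phi \<equiv> (\<lambda>_. 1)"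

definition borel_fun :: "real measure \<Rightarrow> complex \<Rightarrow> complex" where
  "borel_fun M z = L2_inner M (mult_resolvent z phi) phi"

definition perturbed_resolvent ::
  "real measure \<Rightarrow> real \<Rightarrow> complex \<Rightarrow> (real \<Rightarrow> complex) \<Rightarrow> real \<Rightarrow> complex" where
  "perturbed_resolvent M a z f t =
     mult_resolvent z f t
       - of_real a * L2_inner M (mult_resolvent z f) phi / (1 + of_real a * borel_fun M z)
           * mult_resolvent z phi t"

definition rank_one_perturbation ::
  "real measure \<Rightarrow> real \<Rightarrow> ((real \<Rightarrow> complex) \<times> (real \<Rightarrow> complex)) set \<Rightarrow> bool" where
  "rank_one_perturbation M a G \<longleftrightarrow>
     L2_self_adjoint M G \<and>
     (\<forall>z. z \<notin> \<real> \<longrightarrow>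
        L2_resolvent M G z =
          {(f, h). f \<in> L2 M \<and> h \<in> L2 M \<and> (AE t in M. h t = perturbed_resolvent M a z f t)})"


section \<open>Spectral measure and spectral representation\<close>

definition spectral_measure :: "real measure \<Rightarrow> real \<Rightarrow> real measure \<Rightarrow> bool" where
  "spectral_measure M a N \<longleftrightarrow>
     sets N = sets borel \<and>
     (\<forall>z. z \<notin> \<real> \<longrightarrow>
        has_bochner_integral N (\<lambda>s. 1 / (of_real s - z))
          (L2_inner M (perturbed_resolvent M a z phi) phi))"

text \<open>
  The second conjunct is the operator identity $V G = M_s V$, domains included: both sides are
  graphs of operators from $L^2(M)$ to $L^2(N)$.
\<close>

definition spectral_representation ::
  "real measure \<Rightarrow> real \<Rightarrow> ((real \<Rightarrow> complex) \<times> (real \<Rightarrow> complex)) set \<Rightarrow> real measure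
     \<Rightarrow> ((real \<Rightarrow> complex) \<Rightarrow> (real \<Rightarrow> complex)) \<Rightarrow> bool" where
  "spectral_representation M a G N V \<longleftrightarrow>
     L2_unitary M N V \<and>
     (\<forall>f \<in> L2 M. \<forall>k \<in> L2 N.
        (\<exists>g. (f, g) \<in> G \<and> (AE s in N. k s = V g s)) \<longleftrightarrow> (V f, k) \<in> mult_op N) \<and>
     (\<forall>z. z \<notin> \<real> \<longrightarrow>
        (AE s in N. V (perturbed_resolvent M a z phi) s = 1 / (of_real s - z)))"

definition diff_quot :: "(real \<Rightarrow> complex) \<Rightarrow> real \<Rightarrow> real \<Rightarrow> complex" where
  "diff_quot f s t =
     (if t = s then vector_derivative f (at s) else (f s - f t) / of_real (s - t))"


section \<open>Consistency of the explicit resolvent formulas\<close>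

lemma L2_add:
  assumes "f \<in> L2 M" "g \<in> L2 M"
  shows "(\<lambda>x. f x + g x) \<in> L2 M"
proof -
  have [measurable]: "f \<in> borel_measurable M" "g \<in> borel_measurable M"
    using assms by (auto simp: L2_def)
  have "integrable M (\<lambda>x. 2 * (cmod (f x))\<^sup>2 + 2 * (cmod (g x))\<^sup>2)"
    using assms by (auto simp: L2_def)
  moreover have "(cmod (f x + g x))\<^sup>2 \<le> 2 * (cmod (f x))\<^sup>2 + 2 * (cmod (g x))\<^sup>2" for x
  proof -
    have "(cmod (f x + g x))\<^sup>2 \<le> (cmod (f x) + cmod (g x))\<^sup>2"
      by (simp add: norm_triangle_ineq power_mono)
    also have "\<dots> \<le> 2 * (cmod (f x))\<^sup>2 + 2 * (cmod (g x))\<^sup>2"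
      using sum_squares_bound[of "cmod (f x)" "cmod (g x)"] by (simp add: power2_sum)
    finally show ?thesis .
  qed
  ultimately have "integrable M (\<lambda>x. (cmod (f x + g x))\<^sup>2)"
    by (elim Bochner_Integration.integrable_bound) (auto intro!: AE_I2)
  then show ?thesis by (simp add: L2_def)
qed

lemma L2_cmult:
  assumes "f \<in> L2 M"
  shows "(\<lambda>x. c * f x) \<in> L2 M"
  using assms by (auto simp: L2_def norm_mult power_mult_distrib)

lemma resolvent_mult_op:
  assumes "z \<notin> \<real>"
  shows "L2_resolvent M (mult_op M) z =
           {(f, h). f \<in> L2 M \<and> h \<in> L2 M \<and> (AE t in M. h t = mult_resolvent z f t)}"
proof -
  have nz: "of_real t - z \<noteq> 0" for t :: real
    using assms by auto
  have eq: "f t + z * h t = of_real t * h t \<longleftrightarrow> h t = mult_resolvent z f t"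
    for f h :: "real \<Rightarrow> complex" and t
    using nz[of t] by (auto simp: mult_resolvent_def field_simps)
  show ?thesis
    by (auto simp: L2_resolvent_def mult_op_def eq L2_add L2_cmult)
qed

lemma perturbed_resolvent_phi:
  assumes "1 + of_real a * borel_fun M z \<noteq> 0"
  shows "perturbed_resolvent M a z phi t =
           1 / (1 + of_real a * borel_fun M z) * (1 / (of_real t - z))"
proof -
  have "perturbed_resolvent M a z phi t =
      (1 - of_real a * borel_fun M z / (1 + of_real a * borel_fun M z)) * (1 / (of_real t - z))"
    by (simp add: perturbed_resolvent_def mult_resolvent_def borel_fun_def algebra_simps)
  also have "1 - of_real a * borel_fun M z / (1 + of_real a * borel_fun M z)
      = 1 / (1 + of_real a * borel_fun M z)"
    using assms by (simp add: field_simps)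
  finally show ?thesis .
qed

end

theory Submission
  imports Defs
begin

text \<open>
  Write \<open>T g s = g s - \<alpha> * (LINT t|\<mu>. diff_quot g s t)\<close> for the transform in the claim, and
  \<open>F = borel_fun \<mu>\<close>. The proof compares \<open>V\<close> and \<open>T\<close> on a class of functions where both are
  explicit, and passes to the limit.

  Both operators obey the same commutation rule with the resolvents of multiplication by \<open>t\<close>.
  Since \<open>V\<close> turns the resolvent of the perturbed operator into multiplication by \<open>1 / (s - z)\<close>,
  the resolvent formula for a rank one perturbation, solved for the unperturbed resolvent, gives
  \<open>V (g / (t - z)) s = (V g s + \<alpha> * (LINT t|\<mu>. g t / (t - z))) / (s - z)\<close>
  (\<open>V_mult_resolvent\<close>). Splitting the difference quotient of \<open>g / (t - z)\<close> by the product rule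
  gives the same identity for \<open>T\<close> (\<open>difference_transform_mult_resolvent\<close>). The starting values
  agree as well: the normalisation of \<open>V\<close> on the resolvents of \<open>\<phi>\<close> says that \<open>V (1 / (t - z))\<close> is
  \<open>(1 + \<alpha> * F z) / (s - z)\<close>, which is also \<open>T (1 / (t - z))\<close>; dividing by \<open>1 + \<alpha> * F z\<close> is
  legitimate because off the real axis \<open>F\<close> is real only if \<open>\<mu>\<close> is zero, and then \<open>F\<close> is zero.
  Hence \<open>V = T\<close> on the algebra generated by the functions \<open>1 / (t - z)\<close>, without a constant term
  (\<open>V_resolvent_polynomial\<close>).

  For the limit, a single norm controls everything: \<open>decays C g\<close> bounds \<open>(1 + \<bar>t\<bar>) * g t\<close> and
  the derivative of \<open>g\<close> by \<open>C\<close>. As \<open>1 / (1 + \<bar>t\<bar>)\<close> is \<open>\<mu>\<close>-integrable, this bounds the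
  $L^2(\mu)$ norm of \<open>g\<close>, hence the norm of \<open>V g\<close>, and it bounds the difference quotients of \<open>g\<close>
  by a multiple of \<open>1 / (1 + \<bar>t\<bar>)\<close> for each fixed \<open>s\<close>, hence \<open>T g s\<close> pointwise. It remains
  to approximate a compactly supported $C^1$ function \<open>f\<close> in this norm by elements of the algebra
  (\<open>resolvent_polynomial_dense\<close>). The Cayley transform \<open>u = (t - \<i>) / (t + \<i>)\<close> carries the
  compactified line to the unit circle, where the Stone-Weierstrass theorem approximates the
  continuous function \<open>(1 + t\<^sup>2) * f'(t)\<close> uniformly by Laurent polynomials in \<open>u\<close>. Dividing by
  \<open>1 + t\<^sup>2\<close> and integrating yields approximations of \<open>f\<close> itself, because \<open>u ^ k / (1 + t\<^sup>2)\<close> has the rational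
  antiderivative \<open>(u ^ k - 1) / (2 * \<i> * k)\<close> for \<open>k \<noteq> 0\<close>, an element of the algebra. The only obstruction, the
  constant Laurent coefficient, is small because the integral of \<open>f'\<close> is zero.
\<close>


section \<open>Decaying functions with bounded derivative\<close>

text \<open>
  The balls of the norm in which $C^1$ functions are approximated. The decay rate is the weight
  whose integral is assumed to be finite.
\<close>

definition decays :: "real \<Rightarrow> (real \<Rightarrow> complex) \<Rightarrow> bool" where
  "decays C g \<longleftrightarrow> (\<forall>t. g differentiable (at t)) \<and>
     (\<forall>t. cmod (g t) \<le> C / (1 + \<bar>t\<bar>)) \<and> (\<forall>t. cmod (vector_derivative g (at t)) \<le> C)"

lemma decaysI:
  assumes "\<And>t. (g has_vector_derivative g' t) (at t)"
    and "\<And>t. cmod (g t) \<le> C / (1 + \<bar>t\<bar>)" "\<And>t. cmod (g' t) \<le> C"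
  shows "decays C g"
  unfolding decays_def using assms
  by (metis differentiableI_vector vector_derivative_at)

lemma decaysD:
  assumes "decays C g"
  shows "(g has_vector_derivative vector_derivative g (at t)) (at t)"
    and "cmod (g t) \<le> C / (1 + \<bar>t\<bar>)" and "cmod (vector_derivative g (at t)) \<le> C"
    and "0 \<le> C"
proof -
  show "(g has_vector_derivative vector_derivative g (at t)) (at t)"
    using assms by (simp add: decays_def vector_derivative_works)
  show "cmod (g t) \<le> C / (1 + \<bar>t\<bar>)" "cmod (vector_derivative g (at t)) \<le> C"
    using assms by (simp_all add: decays_def)
  then show "0 \<le> C" by (meson norm_ge_zero order_trans)
qed

lemma bounded_of_decays:
  assumes g: "decays C g"
  shows "cmod (g t) \<le> C"
proof -
  have "C / (1 + \<bar>t\<bar>) \<le> C" using decaysD(4)[OF g] by (simp add: divide_le_eq mult_le_cancel_left1)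
  then show ?thesis using decaysD(2)[OF g, of t] by linarith
qed

lemma decays_add:
  assumes "decays C g" "decays D h"
  shows "decays (C + D) (\<lambda>t. g t + h t)"
proof (rule decaysI)
  fix t
  show "((\<lambda>t. g t + h t) has_vector_derivative vector_derivative g (at t) + vector_derivative h (at t)) (at t)"
    by (intro has_vector_derivative_add decaysD[OF assms(1)] decaysD[OF assms(2)])
  show "cmod (g t + h t) \<le> (C + D) / (1 + \<bar>t\<bar>)"
    using decaysD(2)[OF assms(1), of t] decaysD(2)[OF assms(2), of t]
    by (simp add: add_divide_distrib norm_triangle_mono)
  show "cmod (vector_derivative g (at t) + vector_derivative h (at t)) \<le> C + D"
    by (intro norm_triangle_mono decaysD[OF assms(1)] decaysD[OF assms(2)])
qed

lemma decays_scale: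
  assumes "decays C g"
  shows "decays (cmod c * C) (\<lambda>t. c * g t)"
proof (rule decaysI)
  fix t
  show "((\<lambda>t. c * g t) has_vector_derivative c * vector_derivative g (at t)) (at t)"
    by (intro has_vector_derivative_mult_right decaysD[OF assms(1)])
  show "cmod (c * g t) \<le> cmod c * C / (1 + \<bar>t\<bar>)"
    using mult_left_mono[OF decaysD(2)[OF assms(1), of t], of "cmod c"] by (simp add: norm_mult)
  show "cmod (c * vector_derivative g (at t)) \<le> cmod c * C"
    by (simp add: norm_mult mult_left_mono decaysD[OF assms(1)])
qed

lemma Im_nonzero_of_nonreal: "z \<notin> \<real> \<Longrightarrow> Im z \<noteq> 0"
  by (simp add: complex_is_Real_iff)

lemma nonreal_denominator:
  fixes t :: real
  assumes "z \<notin> \<real>"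
  shows "\<bar>Im z\<bar> \<le> cmod (of_real t - z)" and "0 < cmod (of_real t - z)"
proof -
  show ge: "\<bar>Im z\<bar> \<le> cmod (of_real t - z)" using abs_Im_le_cmod[of "of_real t - z"] by simp
  then show "0 < cmod (of_real t - z)" using Im_nonzero_of_nonreal[OF assms] by linarith
qed

lemma has_vector_derivative_resolvent:
  fixes z :: complex
  assumes "z \<notin> \<real>"
  shows "((\<lambda>t. 1 / (of_real t - z)) has_vector_derivative - (1 / (of_real t - z)\<^sup>2)) (at t)"
proof (rule has_vector_derivative_real_field[where f = "\<lambda>w. 1 / (w - z)"])
  have "of_real t - z \<noteq> 0"
    using nonreal_denominator(2)[OF assms, of t] unfolding zero_less_norm_iff .
  then show "((\<lambda>w. 1 / (w - z)) has_field_derivative - (1 / (of_real t - z)\<^sup>2)) (at (of_real t))"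
    by (auto intro!: derivative_eq_intros simp: power2_eq_square)
qed

lemma decays_resolvent:
  assumes "z \<notin> \<real>"
  shows "\<exists>C. decays C (\<lambda>t. 1 / (of_real t - z))"
proof -
  define y where "y = \<bar>Im z\<bar>"
  have y: "y > 0" using Im_nonzero_of_nonreal[OF assms] by (simp add: y_def)
  define C where "C = (1 + cmod z) / y + 1"
  have C: "C > 0" using y by (simp add: C_def add_nonneg_pos)
  show ?thesis
  proof (rule exI, rule decaysI[OF has_vector_derivative_resolvent[OF assms]])
    fix t :: real
    let ?d = "cmod (of_real t - z)"
    have d: "y \<le> ?d" "?d > 0" using nonreal_denominator[OF assms, of t] by (auto simp: y_def)
    have "\<bar>t\<bar> \<le> cmod z + ?d" using norm_triangle_ineq[of z "of_real t - z"] by simp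
    moreover have "1 + cmod z \<le> (1 + cmod z) / y * ?d"
      using d y mult_left_mono[of y ?d "(1 + cmod z) / y"] by simp
    ultimately have *: "1 + \<bar>t\<bar> \<le> C * ?d" by (simp add: C_def distrib_right)
    then show "cmod (1 / (of_real t - z)) \<le> (max C (1 / y\<^sup>2)) / (1 + \<bar>t\<bar>)"
    proof -
      have "1 / ?d \<le> C / (1 + \<bar>t\<bar>)" using * d by (simp add: field_simps)
      also have "\<dots> \<le> (max C (1 / y\<^sup>2)) / (1 + \<bar>t\<bar>)" by (simp add: divide_right_mono)
      finally show ?thesis by (simp add: norm_divide)
    qed
    have "1 / ?d\<^sup>2 \<le> 1 / y\<^sup>2" using d y by (simp add: frac_le power_mono)
    then show "cmod (- (1 / (of_real t - z)\<^sup>2)) \<le> max C (1 / y\<^sup>2)"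
      by (simp add: norm_divide norm_power)
  qed
qed

lemma decays_mult_resolvent_phi:
  assumes "z \<notin> \<real>"
  shows "\<exists>C. decays C (mult_resolvent z phi)"
  using decays_resolvent[OF assms] by (simp add: mult_resolvent_def[abs_def])

lemma decays_mult_resolvent:
  assumes z: "z \<notin> \<real>" and "\<exists>C. decays C g"
  shows "\<exists>C. decays C (mult_resolvent z g)"
proof -
  obtain C where C: "decays C g" using assms by blast
  define y where "y = \<bar>Im z\<bar>"
  have y: "y > 0" using Im_nonzero_of_nonreal[OF z] by (simp add: y_def)
  have C0: "0 \<le> C" using decaysD(4)[OF C] .
  have bound: "cmod (1 / (of_real t - z)) \<le> 1 / y" for t :: real
    using nonreal_denominator(1)[OF z, of t] y by (simp add: norm_divide frac_le y_def)
  have eq: "mult_resolvent z g = (\<lambda>t. g t * (1 / (of_real t - z)))"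
    by (simp add: mult_resolvent_def fun_eq_iff)
  define D where "D = C / y + C / y\<^sup>2"
  have "decays D (mult_resolvent z g)"
    unfolding eq
  proof (rule decaysI)
    fix t :: real
    show "((\<lambda>t. g t * (1 / (of_real t - z))) has_vector_derivative
        g t * (- (1 / (of_real t - z)\<^sup>2)) + vector_derivative g (at t) * (1 / (of_real t - z))) (at t)"
      by (intro has_vector_derivative_mult decaysD(1)[OF C] has_vector_derivative_resolvent z)
    have "cmod (g t * (1 / (of_real t - z))) \<le> C / (1 + \<bar>t\<bar>) * (1 / y)"
      unfolding norm_mult by (intro mult_mono decaysD(2)[OF C] bound) (use C0 in auto)
    also have "\<dots> = (C / y) / (1 + \<bar>t\<bar>)" by (simp add: mult.commute)
    also have "\<dots> \<le> D / (1 + \<bar>t\<bar>)"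
      using C0 y by (intro divide_right_mono) (auto simp: D_def)
    finally show "cmod (g t * (1 / (of_real t - z))) \<le> D / (1 + \<bar>t\<bar>)" .
    have "cmod (g t * (- (1 / (of_real t - z)\<^sup>2))) \<le> C * (1 / y)\<^sup>2"
      unfolding norm_mult
      by (rule mult_mono[OF bounded_of_decays[OF C]]) (use C0 power_mono[OF bound[of t], of 2] in \<open>auto simp: norm_divide norm_power power_divide\<close>)
    moreover have "cmod (vector_derivative g (at t) * (1 / (of_real t - z))) \<le> C * (1 / y)"
      unfolding norm_mult by (intro mult_mono decaysD(3)[OF C] bound) (use C0 in auto)
    ultimately show "cmod (g t * (- (1 / (of_real t - z)\<^sup>2)) + vector_derivative g (at t) * (1 / (of_real t - z))) \<le> D"
      by (intro order_trans[OF norm_triangle_ineq]) (simp add: D_def power_divide)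
  qed
  then show ?thesis by blast
qed

section \<open>The algebra generated by the resolvent functions\<close>

text \<open>
  Polynomials without constant term in the functions \<open>1 / (t - z)\<close>. Products enter only through
  multiplication by one generator at a time, which is the step that both \<open>V\<close> and the difference
  quotient formula can follow.
\<close>

inductive resolvent_polynomial :: "(real \<Rightarrow> complex) \<Rightarrow> bool" where
  resolvent: "z \<notin> \<real> \<Longrightarrow> resolvent_polynomial (mult_resolvent z phi)"
| mult: "z \<notin> \<real> \<Longrightarrow> resolvent_polynomial g \<Longrightarrow> resolvent_polynomial (mult_resolvent z g)"
| add: "resolvent_polynomial g \<Longrightarrow> resolvent_polynomial h \<Longrightarrow> resolvent_polynomial (\<lambda>t. g t + h t)"
| scale: "resolvent_polynomial g \<Longrightarrow> resolvent_polynomial (\<lambda>t. c * g t)"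

lemma resolvent_polynomial_decays:
  "resolvent_polynomial g \<Longrightarrow> \<exists>C. decays C g"
proof (induction rule: resolvent_polynomial.induct)
qed (blast intro: decays_add decays_scale decays_mult_resolvent decays_mult_resolvent_phi)+

lemma decays_tendsto_0:
  assumes "decays C g"
  shows "(g \<longlongrightarrow> 0) at_top" "(g \<longlongrightarrow> 0) at_bot"
proof -
  have top: "filterlim (\<lambda>t::real. 1 + \<bar>t\<bar>) at_top at_top"
    by (intro filterlim_tendsto_add_at_top[OF tendsto_const] filterlim_abs_real)
  then have "filterlim (\<lambda>t::real. 1 + \<bar>t\<bar>) at_top at_bot"
    by (simp add: filterlim_at_bot_mirror)
  with top have 1: "((\<lambda>t::real. C / (1 + \<bar>t\<bar>)) \<longlongrightarrow> 0) at_top" "((\<lambda>t::real. C / (1 + \<bar>t\<bar>)) \<longlongrightarrow> 0) at_bot"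
    by (auto intro!: tendsto_divide_0[OF tendsto_const] filterlim_at_top_imp_at_infinity)
  show "(g \<longlongrightarrow> 0) at_top" "(g \<longlongrightarrow> 0) at_bot"
    by (rule Lim_null_comparison[OF _ 1(1)] Lim_null_comparison[OF _ 1(2)],
        intro always_eventually allI decaysD(2)[OF assms])+
qed

section \<open>Laurent polynomials in the Cayley variable\<close>

definition cayley :: "real \<Rightarrow> complex" where
  "cayley t = (of_real t - \<i>) / (of_real t + \<i>)"

lemma real_plus_i_nonzero: "of_real t + \<i> \<noteq> 0" "of_real t - \<i> \<noteq> 0"
proof -
  have "Im (of_real t + \<i>) \<noteq> Im 0" "Im (of_real t - \<i>) \<noteq> Im 0" by simp_all
  then show "of_real t + \<i> \<noteq> 0" "of_real t - \<i> \<noteq> 0" by metis+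
qed

lemma cayley_nonzero: "cayley t \<noteq> 0"
  using real_plus_i_nonzero[of t] by (simp add: cayley_def)

lemma norm_cayley: "cmod (cayley t) = 1"
proof -
  have "cmod (of_real t - \<i>) = cmod (of_real t + \<i>)" by (simp add: cmod_def)
  then show ?thesis using real_plus_i_nonzero by (simp add: cayley_def norm_divide)
qed

lemma cnj_cayley: "cnj (cayley t) = inverse (cayley t)"
proof (rule inverse_unique[symmetric])
  show "cayley t * cnj (cayley t) = 1"
    using complex_norm_square[of "cayley t"] by (simp add: norm_cayley)
qed

text \<open>
  Trigonometric polynomials on the circle, pulled back to the line. Spanning by the powers of
  \<open>cayley\<close>, rather than by products of real coordinates, makes antiderivatives explicit.
\<close>

inductive cayley_polynomial :: "(real \<Rightarrow> complex) \<Rightarrow> bool" where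
  power: "cayley_polynomial (\<lambda>t. cayley t powi k)"
| add: "cayley_polynomial p \<Longrightarrow> cayley_polynomial q \<Longrightarrow> cayley_polynomial (\<lambda>t. p t + q t)"
| scale: "cayley_polynomial p \<Longrightarrow> cayley_polynomial (\<lambda>t. c * p t)"

lemma cayley_polynomial_mult:
  assumes "cayley_polynomial p" "cayley_polynomial q"
  shows "cayley_polynomial (\<lambda>t. p t * q t)"
  using assms(1)
proof induction
  case (power k)
  show ?case using assms(2)
  proof induction
    case (power l)
    show ?case using cayley_polynomial.power[of "k + l"]
      by (simp add: power_int_add cayley_nonzero)
  next
    case (add p q)
    then show ?case using cayley_polynomial.add by (fastforce simp: distrib_left)
  next
    case (scale p c)
    then show ?case using cayley_polynomial.scale[of _ c] by (fastforce simp: mult_ac)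
  qed
next
  case (add p q)
  then show ?case using cayley_polynomial.add by (fastforce simp: distrib_right)
next
  case (scale p c)
  then show ?case using cayley_polynomial.scale[of _ c] by (fastforce simp: mult_ac)
qed

lemma cayley_polynomial_const: "cayley_polynomial (\<lambda>_. c)"
  using cayley_polynomial.scale[OF cayley_polynomial.power[of 0], of c] by simp

text \<open>
  On the unit circle, conjugation is inversion, so both real coordinates are combinations of
  \<open>u\<close> and its inverse.
\<close>

lemma cayley_polynomial_real_polynomial:
  assumes "real_polynomial_function p"
  shows "cayley_polynomial (\<lambda>t. of_real (p (cayley t)))"
  using assms
proof induction
  case (linear f)
  have fu: "of_real (f (cayley t)) = (of_real (f 1) / 2 + of_real (f \<i>) / (2 * \<i>)) * cayley t powi 1
        + (of_real (f 1) / 2 - of_real (f \<i>) / (2 * \<i>)) * cayley t powi (- 1)" for t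
  proof -
    let ?u = "cayley t"
    have "f ?u = f (Re ?u *\<^sub>R 1 + Im ?u *\<^sub>R \<i>)"
      by (rule arg_cong[of _ _ f]) (simp add: complex_eq_iff)
    also have "\<dots> = Re ?u * f 1 + Im ?u * f \<i>"
      using linear by (simp add: linear_simps)
    finally have "of_real (f ?u) = of_real (Re ?u) * of_real (f 1) + of_real (Im ?u) * (of_real (f \<i>) :: complex)"
      by simp
    moreover have "of_real (Re ?u) = (?u + inverse ?u) / 2" "of_real (Im ?u) = (?u - inverse ?u) / (2 * \<i>)"
      unfolding cnj_cayley[symmetric] by (simp_all add: complex_eq_iff)
    ultimately have "of_real (f ?u) = (?u + inverse ?u) / 2 * of_real (f 1)
        + (?u - inverse ?u) / (2 * \<i>) * of_real (f \<i>)"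
      by (simp only:)
    then show ?thesis by (simp add: power_int_minus algebra_simps add_divide_distrib diff_divide_distrib)
  qed
  show ?case unfolding fu by (intro cayley_polynomial.intros)
next
  case (const c)
  show ?case by (rule cayley_polynomial_const)
qed (simp_all add: cayley_polynomial.add cayley_polynomial_mult)

text \<open>
  A function vanishing near infinity extends by zero to the missing point \<open>1\<close> of the circle, so
  Stone-Weierstrass applies on a compact set and the error is uniform on the whole line.
\<close>

lemma cayley_polynomial_dense:
  fixes h :: "real \<Rightarrow> complex"
  assumes cont: "continuous_on UNIV h" and supp: "\<And>t. \<bar>t\<bar> > R \<Longrightarrow> h t = 0" and e: "0 < e"
  shows "\<exists>q. cayley_polynomial q \<and> (\<forall>t. cmod (h t - q t) < e)"
proof -
  define uncayley where "uncayley = (\<lambda>w::complex. \<i> * (1 + w) / (1 - w))"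
  define H where "H = (\<lambda>w. if w = 1 then 0 else h (Re (uncayley w)))"
  \<comment> \<open>Within distance \<open>r\<close> of \<open>1\<close> the circle consists of images of points with \<open>\<bar>t\<bar> > \<bar>R\<bar>\<close>.\<close>
  define r where "r = 1 / (1 + \<bar>R\<bar>)"
  have r: "r > 0" by (simp add: r_def)
  let ?S = "sphere (0::complex) 1"
  have uncayley_cayley: "uncayley (cayley t) = of_real t" for t
    using real_plus_i_nonzero[of t] by (simp add: uncayley_def cayley_def field_simps)
  have H_cayley: "H (cayley t) = h t" for t
  proof -
    have "cayley t \<noteq> 1"
    proof
      assume "cayley t = 1"
      then have "of_real t - \<i> = of_real t + \<i>" using real_plus_i_nonzero by (simp add: cayley_def)
      then have "Im (of_real t - \<i>) = Im (of_real t + \<i>)" by (rule arg_cong)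
      then show False by simp
    qed
    then show ?thesis by (simp add: H_def uncayley_cayley)
  qed
  have uncayley_real: "uncayley w \<in> \<real>" if "cmod w = 1" "w \<noteq> 1" for w
  proof -
    have "w \<noteq> 0" using that by auto
    have "cnj w = 1 / w"
      using that(1) by (metis complex_norm_square inverse_eq_divide inverse_unique of_real_1 one_power2)
    then have "cnj (uncayley w) = uncayley w"
      using that \<open>w \<noteq> 0\<close> by (simp add: uncayley_def field_simps)
    then show ?thesis by (simp add: Reals_cnj_iff)
  qed
  have H_near: "H w = 0" if "cmod w = 1" "dist 1 w < r" for w
  proof (cases "w = 1")
    case False
    have d: "cmod (1 - w) < r" "0 < cmod (1 - w)" using that False by (auto simp: dist_norm)
    have "2 - r < cmod (1 + w)"
    proof -
      have "cmod (2::complex) = cmod ((1 + w) + (1 - w))" by simp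
      also have "\<dots> \<le> cmod (1 + w) + cmod (1 - w)" by (rule norm_triangle_ineq)
      finally show ?thesis using d by simp
    qed
    moreover have "\<bar>R\<bar> * cmod (1 - w) \<le> \<bar>R\<bar> * r" using d by (intro mult_left_mono) auto
    moreover have "\<bar>R\<bar> * r = 1 - r" by (simp add: r_def field_simps)
    ultimately have "\<bar>R\<bar> * cmod (1 - w) < cmod (1 + w)" by linarith
    then have "\<bar>R\<bar> < cmod (1 + w) / cmod (1 - w)" using d by (simp only: pos_less_divide_eq)
    also have "\<dots> = cmod (uncayley w)" by (simp only: uncayley_def norm_divide norm_mult norm_ii mult_1_left)
    also have "\<dots> = \<bar>Re (uncayley w)\<bar>" using uncayley_real[OF that(1) False] by (rule in_Reals_norm)
    finally show ?thesis using supp False by (simp add: H_def)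
  qed (simp add: H_def)
  have "continuous_on ((?S - {1}) \<union> (?S \<inter> ball 1 r)) H"
  proof (rule continuous_on_Un_local_open)
    have un: "(?S - {1}) \<union> (?S \<inter> ball 1 r) = ?S" using r by auto
    show "openin (top_of_set ((?S - {1}) \<union> (?S \<inter> ball 1 r))) (?S - {1})"
      unfolding un by (metis Diff_eq openin_open_Int open_Compl closed_singleton)
    show "openin (top_of_set ((?S - {1}) \<union> (?S \<inter> ball 1 r))) (?S \<inter> ball 1 r)"
      unfolding un by (simp add: openin_open_Int)
    have "continuous_on (?S - {1}) (\<lambda>w. h (Re (uncayley w)))"
      unfolding uncayley_def
      by (intro continuous_on_compose2[OF cont] continuous_intros) auto
    then show "continuous_on (?S - {1}) H"
      by (rule continuous_on_eq) (simp add: H_def)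
    show "continuous_on (?S \<inter> ball 1 r) H"
      by (rule continuous_on_eq[of _ "\<lambda>_. 0"]) (simp_all add: H_near)
  qed
  moreover have "(?S - {1}) \<union> (?S \<inter> ball 1 r) = ?S" using r by auto
  ultimately have "continuous_on ?S H" by metis
  then obtain g where g: "polynomial_function g" "\<forall>w\<in>?S. cmod (H w - g w) < e"
    using Stone_Weierstrass_polynomial_function[OF compact_sphere _ e, of 0 1 H] by blast
  have "real_polynomial_function (\<lambda>w. Re (g w))" "real_polynomial_function (\<lambda>w. Im (g w))"
    using g(1) bounded_linear_Re bounded_linear_Im by (auto simp: polynomial_function_def o_def)
  then have "cayley_polynomial (\<lambda>t. of_real (Re (g (cayley t))) + \<i> * of_real (Im (g (cayley t))))"
    by (intro cayley_polynomial.add cayley_polynomial.scale cayley_polynomial_real_polynomial)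
  then have "cayley_polynomial (\<lambda>t. g (cayley t))"
    by (simp add: complex_eq[symmetric])
  moreover have "cmod (h t - g (cayley t)) < e" for t
    using g(2) H_cayley[of t] norm_cayley[of t] by force
  ultimately show ?thesis by blast
qed

text \<open>
  The Cayley variable and its inverse are both of the form \<open>1 + c / (t - z)\<close>, with \<open>z = - \<i>\<close> and
  \<open>z = \<i>\<close>. Subtracting \<open>1\<close> removes the value at infinity, where all elements of the algebra vanish.
\<close>

lemma resolvent_polynomial_cayley_power:
  "resolvent_polynomial (\<lambda>t. cayley t powi k - 1)"
proof -
  have nat_case: "resolvent_polynomial (\<lambda>t. v t ^ n - 1)"
    if v: "\<And>t. v t = 1 + c * (1 / (of_real t - z))" and z: "z \<notin> \<real>" for v :: "real \<Rightarrow> complex" and c z n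
  proof (induction n)
    case 0
    show ?case using resolvent_polynomial.scale[OF resolvent_polynomial.resolvent[OF z], of 0] by simp
  next
    case (Suc n)
    have step: "(\<lambda>t. v t ^ Suc n - 1) = (\<lambda>t. (v t ^ n - 1)
        + (c * mult_resolvent z (\<lambda>t. v t ^ n - 1) t + c * mult_resolvent z phi t))"
    proof (rule ext)
      fix t
      have "v t ^ Suc n - 1 = (1 + c * (1 / (of_real t - z))) * v t ^ n - 1" by (simp only: v[symmetric] power_Suc)
      then show "v t ^ Suc n - 1 = (v t ^ n - 1)
        + (c * mult_resolvent z (\<lambda>t. v t ^ n - 1) t + c * mult_resolvent z phi t)"
        by (simp add: mult_resolvent_def algebra_simps diff_divide_distrib)
    qed
    show ?case
      unfolding step using Suc z by (intro resolvent_polynomial.intros)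
  qed
  have i: "\<i> \<notin> \<real>" "- \<i> \<notin> \<real>" by (simp_all add: complex_is_Real_iff)
  show ?thesis
  proof (cases "0 \<le> k")
    case True
    have "cayley t = 1 + (- 2 * \<i>) * (1 / (of_real t - (- \<i>)))" for t
      using real_plus_i_nonzero[of t] by (simp add: cayley_def field_simps)
    from nat_case[OF this i(2), of "nat k"] show ?thesis using True by (simp add: power_int_def)
  next
    case False
    have "inverse (cayley t) = 1 + (2 * \<i>) * (1 / (of_real t - \<i>))" for t
      using real_plus_i_nonzero[of t] by (simp add: cayley_def field_simps)
    from nat_case[OF this i(1), of "nat (- k)"] show ?thesis using False by (simp add: power_int_def)
  qed
qed

lemma real_square_plus_1_nonzero: "1 + (of_real t)\<^sup>2 \<noteq> (0::complex)"
proof -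
  have "1 + (of_real t)\<^sup>2 = (of_real (1 + t\<^sup>2) :: complex)" by simp
  moreover have "1 + t\<^sup>2 \<noteq> 0" by (metis add_pos_nonneg less_irrefl zero_le_power2 zero_less_one)
  ultimately show ?thesis by (metis of_real_eq_0_iff)
qed

text \<open>
  The logarithmic derivative of the Cayley variable is \<open>2 * \<i> / (1 + t\<^sup>2)\<close>, so the powers are
  eigenfunctions of \<open>(1 + t\<^sup>2) * d/dt\<close>.
\<close>

lemma has_vector_derivative_cayley_power:
  "((\<lambda>t. cayley t powi k) has_vector_derivative
     2 * \<i> * of_int k * cayley t powi k / (1 + (of_real t)\<^sup>2)) (at t)"
proof -
  let ?u = "\<lambda>w. (w - \<i>) / (w + \<i>)" and ?w = "of_real t :: complex"
  have nz: "?w + \<i> \<noteq> 0" "?w - \<i> \<noteq> 0" using real_plus_i_nonzero[of t] by auto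
  have factor: "(?w - \<i>) * (?w + \<i>) = 1 + ?w\<^sup>2" by (simp add: algebra_simps power2_eq_square)
  have "((\<lambda>w. ?u w powi k) has_field_derivative
      of_int k * ?u ?w powi (k - 1) * (2 * \<i> / (?w + \<i>)\<^sup>2)) (at ?w)"
    using nz by (auto intro!: derivative_eq_intros simp: power2_eq_square field_simps)
  from has_vector_derivative_real_field[OF this]
  have 1: "((\<lambda>t. cayley t powi k) has_vector_derivative
      of_int k * cayley t powi (k - 1) * (2 * \<i> / (?w + \<i>)\<^sup>2)) (at t)"
    by (simp add: cayley_def)
  have "cayley t powi (k - 1) = cayley t powi k / cayley t"
    by (simp add: power_int_diff cayley_nonzero)
  moreover have "1 / cayley t * (2 * \<i> / (?w + \<i>)\<^sup>2) = 2 * \<i> / (1 + ?w\<^sup>2)"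
    unfolding factor[symmetric] using nz by (simp add: cayley_def power2_eq_square)
  ultimately have "of_int k * cayley t powi (k - 1) * (2 * \<i> / (?w + \<i>)\<^sup>2)
      = of_int k * cayley t powi k * (2 * \<i> / (1 + ?w\<^sup>2))"
    by (simp only: divide_inverse mult_1_left mult.assoc)
  then show ?thesis using 1 by (simp add: mult_ac)
qed

text \<open>
  The number \<open>m\<close> is the constant Laurent coefficient, whose antiderivative would be a multiple of
  the arctangent rather than a rational function.
\<close>

lemma cayley_polynomial_antiderivative:
  assumes "cayley_polynomial q"
  shows "\<exists>m g. resolvent_polynomial g \<and>
    (\<forall>t. (g has_vector_derivative (q t - m) / (1 + (of_real t)\<^sup>2)) (at t))"
  using assms
proof induction
  case (power k)
  show ?case
  proof (cases "k = 0")
    case True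
    have "resolvent_polynomial (\<lambda>_. 0)"
      using resolvent_polynomial_cayley_power[of 0] by simp
    then show ?thesis using True by (intro exI[of _ 1] exI[of _ "\<lambda>_. 0"]) auto
  next
    case False
    let ?c = "1 / (2 * \<i> * of_int k) :: complex"
    have "((\<lambda>t. ?c * (cayley t powi k - 1)) has_vector_derivative
        ?c * (2 * \<i> * of_int k * cayley t powi k / (1 + (of_real t)\<^sup>2) - 0)) (at t)" for t
      by (intro has_vector_derivative_mult_right has_vector_derivative_diff
          has_vector_derivative_cayley_power has_vector_derivative_const)
    then have "((\<lambda>t. ?c * (cayley t powi k - 1)) has_vector_derivative
        (cayley t powi k - 0) / (1 + (of_real t)\<^sup>2)) (at t)" for t
      using False by simp
    then show ?thesis
      using resolvent_polynomial.scale[OF resolvent_polynomial_cayley_power, of ?c k] by blast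
  qed
next
  case (add p q)
  then obtain m g n h where
    g: "resolvent_polynomial g" "\<And>t. (g has_vector_derivative (p t - m) / (1 + (of_real t)\<^sup>2)) (at t)" and
    h: "resolvent_polynomial h" "\<And>t. (h has_vector_derivative (q t - n) / (1 + (of_real t)\<^sup>2)) (at t)"
    by blast
  have "((\<lambda>t. g t + h t) has_vector_derivative (p t + q t - (m + n)) / (1 + (of_real t)\<^sup>2)) (at t)" for t
    using has_vector_derivative_add[OF g(2) h(2), of t]
    by (simp add: add_divide_distrib[symmetric] algebra_simps)
  then show ?case using resolvent_polynomial.add[OF g(1) h(1)] by blast
next
  case (scale p c)
  then obtain m g where
    g: "resolvent_polynomial g" "\<And>t. (g has_vector_derivative (p t - m) / (1 + (of_real t)\<^sup>2)) (at t)"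
    by blast
  have "((\<lambda>t. c * g t) has_vector_derivative (c * p t - c * m) / (1 + (of_real t)\<^sup>2)) (at t)" for t
    using has_vector_derivative_mult_right[OF g(2), of c t] by (simp add: right_diff_distrib)
  then show ?case using resolvent_polynomial.scale[OF g(1)] by blast
qed

section \<open>Approximation of compactly supported functions\<close>

text \<open>
  Integrate the derivative from \<open>t\<close> to infinity, using that \<open>1 / (1 + x\<^sup>2)\<close> is at most
  \<open>2 / (1 + x)\<^sup>2\<close>, which has the elementary antiderivative \<open>- 2 / (1 + x)\<close>.
\<close>

lemma norm_le_of_derivative_at_top:
  fixes h :: "real \<Rightarrow> complex"
  assumes deriv: "\<And>t. (h has_vector_derivative h' t) (at t)"
    and bound: "\<And>t. cmod (h' t) \<le> e / (1 + t\<^sup>2)"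
    and lim: "(h \<longlongrightarrow> 0) at_top" and t: "0 \<le> t"
  shows "cmod (h t) \<le> 2 * e / (1 + t)"
proof -
  have e: "0 \<le> e" using order_trans[OF norm_ge_zero bound[of 0]] by simp
  have cont: "continuous_on S h" for S
    by (meson continuous_at_imp_continuous_on deriv has_vector_derivative_continuous)
  have "cmod (h b - h t) \<le> 2 * e / (1 + t)" if "t < b" for b
  proof -
    have "cmod (h b - h t) \<le> - (2 * e / (1 + b)) - (- (2 * e / (1 + t)))"
    proof (rule differentiable_bound_general[OF that cont _ deriv])
      show "continuous_on {t..b} (\<lambda>x. - (2 * e / (1 + x)))"
        using t by (intro continuous_intros) auto
      fix x assume x: "t < x" "x < b"
      then show "((\<lambda>x. - (2 * e / (1 + x))) has_vector_derivative 2 * e / (1 + x)\<^sup>2) (at x)"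
        unfolding has_real_derivative_iff_has_vector_derivative[symmetric] using t
        by (auto intro!: derivative_eq_intros simp: power2_eq_square)
      have "(1 + x)\<^sup>2 \<le> 2 * (1 + x\<^sup>2)"
        using zero_le_power2[of "1 - x"] by (simp add: power2_eq_square algebra_simps)
      moreover have "0 < (1 + x)\<^sup>2" using x t by simp
      ultimately have "2 * e / (2 * (1 + x\<^sup>2)) \<le> 2 * e / (1 + x)\<^sup>2"
        using e by (intro frac_le) auto
      moreover have "2 * e / (2 * (1 + x\<^sup>2)) = e / (1 + x\<^sup>2)"
        by (rule mult_divide_mult_cancel_left) simp
      ultimately have "e / (1 + x\<^sup>2) \<le> 2 * e / (1 + x)\<^sup>2" by (simp only:)
      then show "cmod (h' x) \<le> 2 * e / (1 + x)\<^sup>2" by (rule order_trans[OF bound])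
    qed
    also have "\<dots> \<le> 2 * e / (1 + t)" using e t that by simp
    finally show ?thesis .
  qed
  then have "eventually (\<lambda>b. cmod (h b - h t) \<le> 2 * e / (1 + t)) at_top"
    by (rule eventually_mono[OF eventually_gt_at_top])
  moreover have "((\<lambda>b. cmod (h b - h t)) \<longlongrightarrow> cmod (0 - h t)) at_top"
    by (intro tendsto_intros lim)
  ultimately have "cmod (0 - h t) \<le> 2 * e / (1 + t)"
    by (intro tendsto_upperbound[OF _ _ trivial_limit_at_top_linorder])
  then show ?thesis by simp
qed

lemma norm_le_of_derivative:
  fixes h :: "real \<Rightarrow> complex"
  assumes deriv: "\<And>t. (h has_vector_derivative h' t) (at t)"
    and bound: "\<And>t. cmod (h' t) \<le> e / (1 + t\<^sup>2)"
    and lim: "(h \<longlongrightarrow> 0) at_top" "(h \<longlongrightarrow> 0) at_bot"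
  shows "cmod (h t) \<le> 2 * e / (1 + \<bar>t\<bar>)"
proof (cases "0 \<le> t")
  case True
  then show ?thesis using norm_le_of_derivative_at_top[OF deriv bound lim(1)] by simp
next
  case False
  have "((\<lambda>x. h (- x)) has_vector_derivative - h' (- x)) (at x)" for x
  proof -
    have "((\<lambda>x::real. - x) has_vector_derivative - 1) (at x)"
      unfolding has_real_derivative_iff_has_vector_derivative[symmetric]
      by (auto intro!: derivative_eq_intros)
    from vector_diff_chain_at[OF this deriv] show ?thesis by (simp add: o_def)
  qed
  moreover have "cmod (- h' (- x)) \<le> e / (1 + x\<^sup>2)" for x
    using bound[of "- x"] by simp
  moreover have "((\<lambda>x. h (- x)) \<longlongrightarrow> 0) at_top"
    using lim(2) by (simp add: filterlim_at_bot_mirror)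
  ultimately have "cmod (h (- (- t))) \<le> 2 * e / (1 + (- t))"
    using False by (intro norm_le_of_derivative_at_top) auto
  then show ?thesis using False by simp
qed

text \<open>
  Approximating \<open>f'\<close> in the weighted supremum norm with weight \<open>1 + t\<^sup>2\<close> controls the derivative
  of the error and, because the error vanishes at infinity, also its size.
\<close>

lemma resolvent_polynomial_dense:
  assumes C1: "f C1_differentiable_on UNIV" and supp: "compact (closure {x. f x \<noteq> 0})" and e: "0 < e"
  shows "\<exists>g. resolvent_polynomial g \<and> decays e (\<lambda>t. f t - g t)"
proof -
  obtain D where D: "\<And>t. (f has_vector_derivative D t) (at t)" "continuous_on UNIV D"
    using C1 by (auto simp: C1_differentiable_on_def)
  obtain R where R: "\<And>t. f t \<noteq> 0 \<Longrightarrow> \<bar>t\<bar> \<le> R"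
  proof -
    have "bounded {x. f x \<noteq> 0}"
      using supp bounded_subset[OF compact_imp_bounded closure_subset] by blast
    then show ?thesis using that by (auto simp: bounded_iff)
  qed
  have f0: "f t = 0" if "R < \<bar>t\<bar>" for t using R[of t] that by fastforce
  have D0: "D t = 0" if "R < \<bar>t\<bar>" for t
  proof -
    have "open {t. R < \<bar>t\<bar>}" by (intro open_Collect_less continuous_intros)
    then have "((\<lambda>_. 0) has_vector_derivative D t) (at t)"
      using has_vector_derivative_transform_within_open[OF D(1)[of t], of "{t. R < \<bar>t\<bar>}" "\<lambda>_. 0"] f0 that
      by blast
    then show ?thesis using has_vector_derivative_const vector_derivative_unique_at by blast
  qed
  \<comment> \<open>One factor \<open>2\<close> is lost when the constant coefficient \<open>m\<close> is dropped, another one in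
      the passage from the derivative to the function.\<close>
  define \<delta> where "\<delta> = e / 4"
  have \<delta>: "0 < \<delta>" using e by (simp add: \<delta>_def)
  have "continuous_on UNIV (\<lambda>t. (1 + (of_real t)\<^sup>2) * D t)"
    by (intro continuous_intros D)
  then obtain q where q: "cayley_polynomial q" "\<And>t. cmod ((1 + (of_real t)\<^sup>2) * D t - q t) < \<delta>"
    using cayley_polynomial_dense[of "\<lambda>t. (1 + (of_real t)\<^sup>2) * D t" R \<delta>] \<delta> D0 by auto
  obtain m g where g: "resolvent_polynomial g"
      "\<And>t. (g has_vector_derivative (q t - m) / (1 + (of_real t)\<^sup>2)) (at t)"
    using cayley_polynomial_antiderivative[OF q(1)] by blast
  have norm_weight: "cmod (1 + (of_real t)\<^sup>2) = 1 + t\<^sup>2" for t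
  proof -
    have "1 + (of_real t)\<^sup>2 = (of_real (1 + t\<^sup>2) :: complex)" by simp
    also have "cmod \<dots> = 1 + t\<^sup>2" by (simp only: norm_of_real) simp
    finally show ?thesis .
  qed
  have f_lim: "(f \<longlongrightarrow> 0) at_top" "(f \<longlongrightarrow> 0) at_bot"
    by (rule tendsto_eventually, rule eventually_at_top_linorderI[of "R + 1"], rule f0, simp,
        rule tendsto_eventually, rule eventually_at_bot_linorderI[of "- \<bar>R\<bar> - 1"], rule f0, simp)
  obtain C where C: "decays C g" using resolvent_polynomial_decays[OF g(1)] by blast
  note g_lim = decays_tendsto_0[OF C]
  \<comment> \<open>Up to \<open>m * arctan\<close>, the approximation \<open>g\<close> differs from \<open>f\<close> by a function whose total
      variation is at most \<open>\<delta> * pi\<close>. As \<open>f\<close> and \<open>g\<close> vanish at both ends, comparing the two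
      ends isolates \<open>m * pi\<close>.\<close>
  have m: "cmod m \<le> \<delta>"
  proof -
    define H where "H = (\<lambda>t. f t - g t - m * of_real (arctan t))"
    have H_deriv: "(H has_vector_derivative
        ((1 + (of_real t)\<^sup>2) * D t - q t) / (1 + (of_real t)\<^sup>2)) (at t)" for t
    proof -
      have "(H has_vector_derivative
          D t - (q t - m) / (1 + (of_real t)\<^sup>2) - m * of_real (inverse (1 + t\<^sup>2))) (at t)"
        unfolding H_def
        by (intro has_vector_derivative_diff D g has_vector_derivative_mult_right
            has_vector_derivative_of_real DERIV_arctan)
      also have "D t - (q t - m) / (1 + (of_real t)\<^sup>2) - m * of_real (inverse (1 + t\<^sup>2))
          = ((1 + (of_real t)\<^sup>2) * D t - q t) / (1 + (of_real t)\<^sup>2)"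
        using real_square_plus_1_nonzero[of t]
        by (simp add: inverse_eq_divide diff_divide_distrib)
      finally show ?thesis .
    qed
    have "cmod (H b - H a) \<le> \<delta> * arctan b - \<delta> * arctan a" if "a < b" for a b
    proof (rule differentiable_bound_general[OF that _ _ H_deriv])
      show "continuous_on {a..b} H"
        by (meson continuous_at_imp_continuous_on H_deriv has_vector_derivative_continuous)
      show "continuous_on {a..b} (\<lambda>t. \<delta> * arctan t)" by (intro continuous_intros)
      fix t
      show "((\<lambda>t. \<delta> * arctan t) has_vector_derivative \<delta> * inverse (1 + t\<^sup>2)) (at t)"
        unfolding has_real_derivative_iff_has_vector_derivative[symmetric]
        by (intro DERIV_cmult DERIV_arctan)
      show "cmod (((1 + (of_real t)\<^sup>2) * D t - q t) / (1 + (of_real t)\<^sup>2)) \<le> \<delta> * inverse (1 + t\<^sup>2)"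
        unfolding norm_divide norm_weight unfolding divide_inverse
        using q(2)[of t] by (intro mult_right_mono) auto
    qed
    then have "cmod (H b - H (- b)) \<le> \<delta> * arctan b - \<delta> * arctan (- b)" if "0 < b" for b
      using that by simp
    then have "eventually (\<lambda>b. cmod (H b - H (- b)) \<le> \<delta> * arctan b - \<delta> * arctan (- b)) at_top"
      by (rule eventually_mono[OF eventually_gt_at_top])
    moreover have "((\<lambda>b. cmod (H b - H (- b))) \<longlongrightarrow>
        cmod ((0 - 0 - m * of_real (pi / 2)) - (0 - 0 - m * of_real (- (pi / 2))))) at_top"
      unfolding H_def
      by (intro tendsto_intros f_lim g_lim tendsto_arctan_at_top
          f_lim(2)[unfolded filterlim_at_bot_mirror] g_lim(2)[unfolded filterlim_at_bot_mirror]
          tendsto_arctan_at_bot[unfolded filterlim_at_bot_mirror])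
    moreover have "((\<lambda>b. \<delta> * arctan b - \<delta> * arctan (- b)) \<longlongrightarrow> \<delta> * (pi / 2) - \<delta> * (- (pi / 2))) at_top"
      by (intro tendsto_intros tendsto_arctan_at_top
          tendsto_arctan_at_bot[unfolded filterlim_at_bot_mirror])
    ultimately have "cmod ((0 - 0 - m * of_real (pi / 2)) - (0 - 0 - m * of_real (- (pi / 2))))
        \<le> \<delta> * (pi / 2) - \<delta> * (- (pi / 2))"
      by (intro tendsto_le[OF trivial_limit_at_top_linorder])
    also have "(0 - 0 - m * of_real (pi / 2)) - (0 - 0 - m * of_real (- (pi / 2))) = - (m * of_real pi)"
      by simp
    also have "\<delta> * (pi / 2) - \<delta> * (- (pi / 2)) = \<delta> * pi" by simp
    finally have "cmod m * pi \<le> \<delta> * pi" by (simp add: norm_mult)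
    then show ?thesis by simp
  qed
  define h' where "h' = (\<lambda>t. D t - (q t - m) / (1 + (of_real t)\<^sup>2))"
  have h_deriv: "((\<lambda>t. f t - g t) has_vector_derivative h' t) (at t)" for t
    unfolding h'_def by (intro has_vector_derivative_diff D g)
  have h'_bound: "cmod (h' t) \<le> 2 * \<delta> / (1 + t\<^sup>2)" for t
  proof -
    have "h' t = ((1 + (of_real t)\<^sup>2) * D t - q t + m) / (1 + (of_real t)\<^sup>2)"
      using real_square_plus_1_nonzero[of t]
      by (simp add: h'_def diff_divide_distrib add_divide_distrib)
    then have "cmod (h' t) = cmod ((1 + (of_real t)\<^sup>2) * D t - q t + m) / (1 + t\<^sup>2)"
      by (simp only: norm_divide norm_weight)
    moreover have "cmod ((1 + (of_real t)\<^sup>2) * D t - q t + m) \<le> 2 * \<delta>"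
      using norm_triangle_ineq[of "(1 + (of_real t)\<^sup>2) * D t - q t" m] q(2)[of t] m by linarith
    ultimately show ?thesis by (simp add: divide_right_mono)
  qed
  have "decays e (\<lambda>t. f t - g t)"
  proof (rule decaysI[OF h_deriv])
    fix t
    have "((\<lambda>t. f t - g t) \<longlongrightarrow> 0) at_top" "((\<lambda>t. f t - g t) \<longlongrightarrow> 0) at_bot"
      using tendsto_diff[OF f_lim(1) g_lim(1)] tendsto_diff[OF f_lim(2) g_lim(2)] by simp_all
    from norm_le_of_derivative[OF h_deriv h'_bound this, of t]
    show "cmod (f t - g t) \<le> e / (1 + \<bar>t\<bar>)" by (simp add: \<delta>_def)
    have "2 * \<delta> / (1 + t\<^sup>2) \<le> 2 * \<delta>" using \<delta> by (simp add: divide_le_eq add_pos_nonneg)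
    from order_trans[OF h'_bound this] show "cmod (h' t) \<le> e" using e by (simp add: \<delta>_def)
  qed
  with g(1) show ?thesis by blast
qed

section \<open>Difference quotients\<close>

lemma lipschitz_of_decays:
  assumes g: "decays C g"
  shows "cmod (g s - g t) \<le> C * \<bar>s - t\<bar>"
proof -
  have less: "cmod (g b - g a) \<le> C * (b - a)" if "a < b" for a b
  proof -
    have "cmod (g b - g a) \<le> C * b - C * a"
    proof (rule differentiable_bound_general[OF that _ _ decaysD(1)[OF g]])
      show "continuous_on {a..b} g"
        by (meson continuous_at_imp_continuous_on decaysD(1)[OF g] has_vector_derivative_continuous)
      show "continuous_on {a..b} (\<lambda>t. C * t)" by (intro continuous_intros)
      show "((\<lambda>t. C * t) has_vector_derivative C) (at x)" for x
        unfolding has_real_derivative_iff_has_vector_derivative[symmetric]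
        by (auto intro!: derivative_eq_intros)
    qed (rule decaysD(3)[OF g])
    then show ?thesis by (simp add: right_diff_distrib)
  qed
  show ?thesis
    using less[of s t] less[of t s] norm_minus_commute[of "g s" "g t"]
    by (cases s t rule: linorder_cases) auto
qed

text \<open>
  Near \<open>s\<close> the quotient is bounded by the Lipschitz constant, away from \<open>s\<close> by the supremum of \<open>g\<close>
  divided by the distance; both cases are comparable to the weight \<open>1 / (1 + \<bar>t\<bar>)\<close>.
\<close>

lemma diff_quot_bound:
  assumes g: "decays C g"
  shows "cmod (diff_quot g s t) \<le> 2 * C * (2 + \<bar>s\<bar>) / (1 + \<bar>t\<bar>)"
proof -
  note C = decaysD(4)[OF g]
  have near: "cmod (diff_quot g s t) \<le> C"
  proof (cases "t = s")
    case False
    then show ?thesis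
      using lipschitz_of_decays[OF g, of s t] by (simp add: diff_quot_def norm_divide divide_le_eq del: of_real_diff)
  qed (simp add: diff_quot_def decaysD(3)[OF g])
  have "cmod (diff_quot g s t) * (1 + \<bar>t\<bar>) \<le> 2 * C * (2 + \<bar>s\<bar>)"
  proof (cases "\<bar>t - s\<bar> \<le> 1")
    case True
    then have "cmod (diff_quot g s t) * (1 + \<bar>t\<bar>) \<le> C * (2 + \<bar>s\<bar>)"
      by (intro mult_mono near) (use C in auto)
    also have "\<dots> \<le> 2 * C * (2 + \<bar>s\<bar>)" using C by (intro mult_right_mono) auto
    finally show ?thesis .
  next
    case False
    let ?d = "\<bar>s - t\<bar>"
    have d: "1 < ?d" "t \<noteq> s" using False by auto
    have "cmod (g s - g t) \<le> 2 * C"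
      using norm_triangle_ineq4[of "g s" "g t"] bounded_of_decays[OF g, of s] bounded_of_decays[OF g, of t]
      by linarith
    then have 1: "cmod (diff_quot g s t) \<le> 2 * C / ?d"
      using d by (simp add: diff_quot_def norm_divide divide_right_mono del: of_real_diff)
    have "(1 + \<bar>s\<bar>) * 1 \<le> (1 + \<bar>s\<bar>) * ?d" using d by (intro mult_left_mono) auto
    moreover have "\<bar>t\<bar> \<le> \<bar>s\<bar> + ?d" by simp
    ultimately have "1 + \<bar>t\<bar> \<le> (2 + \<bar>s\<bar>) * ?d" by (simp add: distrib_right)
    then have "cmod (diff_quot g s t) * (1 + \<bar>t\<bar>) \<le> 2 * C / ?d * ((2 + \<bar>s\<bar>) * ?d)"
      by (intro mult_mono 1) (use C in auto)
    also have "\<dots> = 2 * C * (2 + \<bar>s\<bar>)" using d by simp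
    finally show ?thesis .
  qed
  then show ?thesis by (simp add: pos_le_divide_eq)
qed

lemma diff_quot_add:
  assumes "g differentiable (at s)" "h differentiable (at s)"
  shows "diff_quot (\<lambda>t. g t + h t) s t = diff_quot g s t + diff_quot h s t"
  using assms by (auto simp: diff_quot_def add_divide_distrib[symmetric])

lemma diff_quot_scale:
  assumes "g differentiable (at s)"
  shows "diff_quot (\<lambda>t. c * g t) s t = c * diff_quot g s t"
proof -
  have "vector_derivative (\<lambda>t. c * g t) (at s) = c * vector_derivative g (at s)"
    using assms
    by (intro vector_derivative_at has_vector_derivative_mult_right) (simp add: vector_derivative_works)
  then show ?thesis by (simp add: diff_quot_def right_diff_distrib[symmetric])
qed

lemma diff_quot_resolvent:
  assumes z: "z \<notin> \<real>"
  shows "diff_quot (mult_resolvent z phi) s t = - (mult_resolvent z phi t / (of_real s - z))"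
proof -
  have nz: "of_real s - z \<noteq> 0" "of_real t - z \<noteq> 0" using nonreal_denominator(2)[OF z] by (auto simp only: zero_less_norm_iff)
  have "vector_derivative (mult_resolvent z phi) (at s) = - (1 / (of_real s - z)\<^sup>2)"
    unfolding mult_resolvent_def[abs_def] by (intro vector_derivative_at has_vector_derivative_resolvent z)
  moreover have "(1 / (of_real s - z) - 1 / (of_real t - z)) / of_real (s - t)
      = - (1 / (of_real t - z) / (of_real s - z))" if "t \<noteq> s"
  proof -
    have "1 / (of_real s - z) - 1 / (of_real t - z)
        = - of_real (s - t) / ((of_real t - z) * (of_real s - z))"
      using nz by (simp add: diff_frac_eq mult.commute)
    moreover have "(of_real (s - t) :: complex) \<noteq> 0" using that by simp
    ultimately show ?thesis by (simp del: of_real_diff)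
  qed
  ultimately show ?thesis by (simp add: diff_quot_def mult_resolvent_def power2_eq_square)
qed

text \<open>
  The discrete product rule for \<open>g * (1 / (t - z))\<close>; on the diagonal it is the usual product rule.
\<close>

lemma diff_quot_mult_resolvent:
  assumes z: "z \<notin> \<real>" and g: "g differentiable (at s)"
  shows "diff_quot (mult_resolvent z g) s t = (diff_quot g s t - mult_resolvent z g t) / (of_real s - z)"
proof -
  have nz: "of_real s - z \<noteq> 0" "of_real t - z \<noteq> 0" using nonreal_denominator(2)[OF z] by (auto simp only: zero_less_norm_iff)
  have eq: "mult_resolvent z g = (\<lambda>t. g t * (1 / (of_real t - z)))"
    by (simp add: mult_resolvent_def fun_eq_iff)
  have "vector_derivative (mult_resolvent z g) (at s)
      = g s * - (1 / (of_real s - z)\<^sup>2) + vector_derivative g (at s) * (1 / (of_real s - z))"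
    unfolding eq using g
    by (intro vector_derivative_at has_vector_derivative_mult has_vector_derivative_resolvent z)
      (simp add: vector_derivative_works)
  also have "\<dots> = (vector_derivative g (at s) - g s / (of_real s - z)) / (of_real s - z)"
    by (simp add: diff_divide_distrib power2_eq_square)
  finally have deriv: "vector_derivative (mult_resolvent z g) (at s)
      = (vector_derivative g (at s) - g s / (of_real s - z)) / (of_real s - z)" .
  have "(g s / (of_real s - z) - g t / (of_real t - z)) / of_real (s - t)
      = ((g s - g t) / of_real (s - t) - g t / (of_real t - z)) / (of_real s - z)" if "t \<noteq> s"
  proof -
    have "(of_real (s - t) :: complex) \<noteq> 0" using that by simp
    moreover have "g s / (of_real s - z) - g t / (of_real t - z)
        = ((g s - g t) - g t / (of_real t - z) * of_real (s - t)) / (of_real s - z)"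
    proof -
      have "g t / (of_real t - z) * of_real (s - t)
          = g t / (of_real t - z) * ((of_real s - z) - (of_real t - z))" by simp
      also have "\<dots> = g t / (of_real t - z) * (of_real s - z) - g t"
      proof -
        have "x / d * (c - d) = x / d * c - x" if "d \<noteq> 0" for x c d :: complex
          using that by (simp add: right_diff_distrib)
        then show ?thesis using nz(2) .
      qed
      finally show ?thesis using nz(1) by (simp add: diff_divide_distrib)
    qed
    moreover have "(x - y * c) / w / c = (x / c - y) / w" if "c \<noteq> 0" for x y c w :: complex
      using that by (simp add: diff_divide_distrib)
    ultimately show ?thesis by (simp only:)
  qed
  then show ?thesis using deriv by (simp add: diff_quot_def mult_resolvent_def)
qed

section \<open>The difference quotient transform\<close>

locale weighted_measure =
  fixes \<mu> :: "real measure"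
  assumes sets_eq_borel: "sets \<mu> = sets borel"
    and weight_finite: "(\<integral>\<^sup>+ t. ennreal (1 / (1 + \<bar>t\<bar>)) \<partial>\<mu>) < \<infinity>"
begin

definition total_weight :: real where
  "total_weight = (LINT t|\<mu>. 1 / (1 + \<bar>t\<bar>))"

lemma borel_measurable_iff: "f \<in> borel_measurable \<mu> \<longleftrightarrow> f \<in> borel_measurable borel"
  using measurable_cong_sets[OF sets_eq_borel refl] by blast

lemma integrable_weight: "integrable \<mu> (\<lambda>t. 1 / (1 + \<bar>t\<bar>))"
  using weight_finite by (intro integrableI_nonneg) (auto simp: borel_measurable_iff)

lemma integrable_of_weight_bound:
  fixes g :: "real \<Rightarrow> 'b :: {banach, second_countable_topology}"
  assumes "g \<in> borel_measurable \<mu>" and bound: "\<And>t. norm (g t) \<le> C / (1 + \<bar>t\<bar>)"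
  shows "integrable \<mu> g" and "norm (LINT t|\<mu>. g t) \<le> C * total_weight"
proof -
  have int: "integrable \<mu> (\<lambda>t. C * (1 / (1 + \<bar>t\<bar>)))"
    by (intro integrable_mult_right integrable_weight)
  show g: "integrable \<mu> g"
  proof (rule Bochner_Integration.integrable_bound[OF int assms(1)])
    have "norm (g t) \<le> norm (C * (1 / (1 + \<bar>t\<bar>)))" for t
      using order_trans[OF bound abs_ge_self] by simp
    then show "AE t in \<mu>. norm (g t) \<le> norm (C * (1 / (1 + \<bar>t\<bar>)))" by simp
  qed
  have "norm (LINT t|\<mu>. g t) \<le> (LINT t|\<mu>. C * (1 / (1 + \<bar>t\<bar>)))"
    using bound by (intro order_trans[OF integral_norm_bound integral_mono[OF integrable_norm[OF g] int]]) simp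
  then show "norm (LINT t|\<mu>. g t) \<le> C * total_weight"
    unfolding total_weight_def by (simp only: integral_mult_right_zero)
qed

lemma decays_borel_measurable:
  assumes "decays C g"
  shows "g \<in> borel_measurable \<mu>"
proof -
  have "continuous_on UNIV g"
    by (meson continuous_at_imp_continuous_on decaysD(1)[OF assms] has_vector_derivative_continuous)
  then show ?thesis by (simp add: borel_measurable_iff borel_measurable_continuous_onI)
qed

lemma decays_L2:
  assumes g: "decays C g"
  shows "g \<in> L2 \<mu>" and "(LINT t|\<mu>. (cmod (g t))\<^sup>2) \<le> C\<^sup>2 * total_weight"
proof -
  have [measurable]: "g \<in> borel_measurable \<mu>" by (rule decays_borel_measurable[OF g])
  have meas: "(\<lambda>t. (cmod (g t))\<^sup>2) \<in> borel_measurable \<mu>" by measurable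
  have bound: "norm ((cmod (g t))\<^sup>2) \<le> C\<^sup>2 / (1 + \<bar>t\<bar>)" for t
  proof -
    have "cmod (g t) * cmod (g t) \<le> C * (C / (1 + \<bar>t\<bar>))"
      by (intro mult_mono bounded_of_decays[OF g] decaysD(2)[OF g]) (use decaysD(4)[OF g] in auto)
    then show ?thesis by (simp add: power2_eq_square)
  qed
  show "g \<in> L2 \<mu>"
    using integrable_of_weight_bound(1)[OF meas bound] by (simp add: L2_def)
  show "(LINT t|\<mu>. (cmod (g t))\<^sup>2) \<le> C\<^sup>2 * total_weight"
    using integrable_of_weight_bound(2)[OF meas bound] by simp
qed

lemma integrable_decays:
  assumes "decays C g" shows "integrable \<mu> g"
  by (rule integrable_of_weight_bound(1)[OF decays_borel_measurable[OF assms] decaysD(2)[OF assms]])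

lemma integrable_diff_quot:
  assumes g: "decays C g"
  shows "integrable \<mu> (diff_quot g s)"
    and "cmod (LINT t|\<mu>. diff_quot g s t) \<le> 2 * C * (2 + \<bar>s\<bar>) * total_weight"
proof -
  have [measurable]: "g \<in> borel_measurable borel"
    using decays_borel_measurable[OF g] by (simp add: borel_measurable_iff)
  have "diff_quot g s \<in> borel_measurable \<mu>"
    unfolding borel_measurable_iff diff_quot_def[abs_def] by measurable
  from integrable_of_weight_bound[OF this diff_quot_bound[OF g]]
  show "integrable \<mu> (diff_quot g s)"
    and "cmod (LINT t|\<mu>. diff_quot g s t) \<le> 2 * C * (2 + \<bar>s\<bar>) * total_weight" by auto
qed

definition difference_transform :: "real \<Rightarrow> (real \<Rightarrow> complex) \<Rightarrow> real \<Rightarrow> complex" where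
  "difference_transform a g s = g s - of_real a * (LINT t|\<mu>. diff_quot g s t)"

lemma difference_transform_add:
  assumes g: "decays C g" and h: "decays D h"
  shows "difference_transform a (\<lambda>t. g t + h t) s = difference_transform a g s + difference_transform a h s"
proof -
  have "diff_quot (\<lambda>t. g t + h t) s t = diff_quot g s t + diff_quot h s t" for t
    using g h by (intro diff_quot_add) (auto simp: decays_def)
  then show ?thesis
    using integrable_diff_quot(1)[OF g] integrable_diff_quot(1)[OF h]
    by (simp add: difference_transform_def algebra_simps)
qed

lemma difference_transform_scale:
  assumes g: "decays C g"
  shows "difference_transform a (\<lambda>t. c * g t) s = c * difference_transform a g s"
proof -
  have "diff_quot (\<lambda>t. c * g t) s t = c * diff_quot g s t" for t
    using g by (intro diff_quot_scale) (auto simp: decays_def)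
  then show ?thesis
    by (simp add: difference_transform_def algebra_simps)
qed

lemma difference_transform_resolvent:
  assumes z: "z \<notin> \<real>"
  shows "difference_transform a (mult_resolvent z phi) s
    = (1 + of_real a * borel_fun \<mu> z) / (of_real s - z)"
proof -
  have "(LINT t|\<mu>. diff_quot (mult_resolvent z phi) s t) = - (borel_fun \<mu> z / (of_real s - z))"
    by (simp add: diff_quot_resolvent[OF z] borel_fun_def L2_inner_def)
  moreover have "mult_resolvent z phi s = 1 / (of_real s - z)" by (simp add: mult_resolvent_def)
  ultimately show ?thesis by (simp add: difference_transform_def add_divide_distrib)
qed

lemma difference_transform_mult_resolvent:
  assumes z: "z \<notin> \<real>" and g: "decays C g"
  shows "difference_transform a (mult_resolvent z g) s
    = (difference_transform a g s + of_real a * L2_inner \<mu> (mult_resolvent z g) phi) / (of_real s - z)"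
proof -
  obtain D where "decays D (mult_resolvent z g)" using decays_mult_resolvent[OF z] g by blast
  note int = integrable_decays[OF this] integrable_diff_quot(1)[OF g, of s]
  have "diff_quot (mult_resolvent z g) s t = (diff_quot g s t - mult_resolvent z g t) / (of_real s - z)" for t
    using g by (intro diff_quot_mult_resolvent z) (auto simp: decays_def)
  then have "(LINT t|\<mu>. diff_quot (mult_resolvent z g) s t)
      = ((LINT t|\<mu>. diff_quot g s t) - L2_inner \<mu> (mult_resolvent z g) phi) / (of_real s - z)"
    using int by (simp add: L2_inner_def)
  moreover have "mult_resolvent z g s = g s / (of_real s - z)" by (simp add: mult_resolvent_def)
  ultimately show ?thesis
    by (simp add: difference_transform_def diff_divide_distrib add_divide_distrib right_diff_distrib)
qed

text \<open>
  The imaginary part of the integral of \<open>1 / (t - z)\<close> is the imaginary part of \<open>z\<close> times the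
  integral of the square of its modulus. If the sum were zero, \<open>borel_fun \<mu> z\<close> would be real, hence
  \<open>1 / (t - z)\<close> would vanish almost everywhere and \<open>borel_fun \<mu> z\<close> itself would be \<open>0\<close>.
\<close>

lemma one_plus_borel_fun_nonzero:
  assumes z: "z \<notin> \<real>"
  shows "1 + of_real a * borel_fun \<mu> z \<noteq> 0"
proof
  assume zero: "1 + of_real a * borel_fun \<mu> z = 0"
  obtain C where C: "decays C (mult_resolvent z phi)" using decays_mult_resolvent_phi[OF z] by blast
  have F: "borel_fun \<mu> z = (LINT t|\<mu>. mult_resolvent z phi t)" by (simp add: borel_fun_def L2_inner_def)
  have Im_eq: "Im (mult_resolvent z phi t) = Im z * (cmod (mult_resolvent z phi t))\<^sup>2" for t
    by (simp add: mult_resolvent_def Im_divide norm_divide power_divide cmod_power2)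
  have "Im (borel_fun \<mu> z) = (LINT t|\<mu>. Im (mult_resolvent z phi t))"
    unfolding F using integrable_decays[OF C] by simp
  also have "\<dots> = Im z * (LINT t|\<mu>. (cmod (mult_resolvent z phi t))\<^sup>2)"
    by (simp add: Im_eq)
  finally have Im_F: "Im (borel_fun \<mu> z) = Im z * (LINT t|\<mu>. (cmod (mult_resolvent z phi t))\<^sup>2)" .
  have "a \<noteq> 0" using zero by auto
  moreover have "Im (1 + of_real a * borel_fun \<mu> z) = a * Im (borel_fun \<mu> z)" by simp
  ultimately have "(LINT t|\<mu>. (cmod (mult_resolvent z phi t))\<^sup>2) = 0"
    using zero Im_F Im_nonzero_of_nonreal[OF z] by simp
  then have "AE t in \<mu>. (cmod (mult_resolvent z phi t))\<^sup>2 = 0"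
    using integral_nonneg_eq_0_iff_AE[of \<mu> "\<lambda>t. (cmod (mult_resolvent z phi t))\<^sup>2"] decays_L2(1)[OF C]
    by (simp add: L2_def)
  then have "borel_fun \<mu> z = 0"
    unfolding F by (intro integral_eq_zero_AE) (auto elim: eventually_mono)
  then show False using zero by simp
qed

end

section \<open>The spectral representation\<close>

locale rank_one_spectral_representation = weighted_measure \<mu>
  for \<mu> :: "real measure" +
  fixes \<nu> :: "real measure" and \<alpha> :: real
    and A :: "((real \<Rightarrow> complex) \<times> (real \<Rightarrow> complex)) set"
    and V :: "(real \<Rightarrow> complex) \<Rightarrow> (real \<Rightarrow> complex)"
  assumes rank_one: "rank_one_perturbation \<mu> \<alpha> A"
    and representation: "spectral_representation \<mu> \<alpha> A \<nu> V"
begin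

lemma unitary: "L2_unitary \<mu> \<nu> V"
  using representation by (simp add: spectral_representation_def)

lemma V_L2: "f \<in> L2 \<mu> \<Longrightarrow> V f \<in> L2 \<nu>"
  using unitary by (simp add: L2_unitary_def)

lemma V_add: "f \<in> L2 \<mu> \<Longrightarrow> g \<in> L2 \<mu> \<Longrightarrow> AE s in \<nu>. V (\<lambda>t. f t + g t) s = V f s + V g s"
  using unitary by (simp add: L2_unitary_def)

lemma V_scale: "f \<in> L2 \<mu> \<Longrightarrow> AE s in \<nu>. V (\<lambda>t. c * f t) s = c * V f s"
  using unitary by (simp add: L2_unitary_def)

lemma V_norm:
  assumes "f \<in> L2 \<mu>"
  shows "(LINT s|\<nu>. (cmod (V f s))\<^sup>2) = (LINT t|\<mu>. (cmod (f t))\<^sup>2)"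
proof -
  have norm: "L2_inner M g g = of_real (LINT x|M. (cmod (g x))\<^sup>2)" for M :: "real measure" and g
    unfolding L2_inner_def by (simp add: complex_norm_square[symmetric] del: of_real_power)
  have "L2_inner \<nu> (V f) (V f) = L2_inner \<mu> f f"
    using unitary assms by (simp add: L2_unitary_def)
  then show ?thesis unfolding norm of_real_eq_iff .
qed

text \<open>
  Intertwining of the operators carries over to resolvents: if \<open>h\<close> is the resolvent of \<open>f\<close>, then the
  operator maps \<open>h\<close> to \<open>f + z * h\<close>, and \<open>V\<close> turns this into \<open>s * V h = V f + z * V h\<close>.
\<close>

lemma V_perturbed_resolvent:
  assumes z: "z \<notin> \<real>" and f: "f \<in> L2 \<mu>" and h: "perturbed_resolvent \<mu> \<alpha> z f \<in> L2 \<mu>"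
  shows "AE s in \<nu>. V (perturbed_resolvent \<mu> \<alpha> z f) s = V f s / (of_real s - z)"
proof -
  let ?h = "perturbed_resolvent \<mu> \<alpha> z f"
  let ?g = "\<lambda>t. f t + z * ?h t"
  have "L2_resolvent \<mu> A z = {(f, h). f \<in> L2 \<mu> \<and> h \<in> L2 \<mu> \<and> (AE t in \<mu>. h t = perturbed_resolvent \<mu> \<alpha> z f t)}"
    using rank_one z by (simp add: rank_one_perturbation_def)
  then have "(f, ?h) \<in> L2_resolvent \<mu> A z" using f h by simp
  then have "(?h, ?g) \<in> A" by (simp add: L2_resolvent_def)
  moreover have zh: "(\<lambda>t. z * ?h t) \<in> L2 \<mu>" by (rule L2_cmult[OF h])
  then have "V ?g \<in> L2 \<nu>" by (intro V_L2 L2_add f)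
  ultimately have "(V ?h, V ?g) \<in> mult_op \<nu>"
    using representation h unfolding spectral_representation_def by blast
  then have "AE s in \<nu>. V ?g s = of_real s * V ?h s" by (simp add: mult_op_def)
  with V_add[OF f zh] V_scale[OF h, of z] show ?thesis
  proof eventually_elim
    case (elim s)
    have "of_real s - z \<noteq> 0" using nonreal_denominator(2)[OF z, of s] by (simp only: zero_less_norm_iff not_False_eq_True)
    then show ?case using elim by (simp add: field_simps)
  qed
qed

lemma V_resolvent:
  assumes z: "z \<notin> \<real>"
  shows "AE s in \<nu>. V (mult_resolvent z phi) s = (1 + of_real \<alpha> * borel_fun \<mu> z) / (of_real s - z)"
proof -
  let ?c = "1 + of_real \<alpha> * borel_fun \<mu> z"
  have c: "?c \<noteq> 0" by (rule one_plus_borel_fun_nonzero[OF z])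
  have eq: "mult_resolvent z phi = (\<lambda>t. ?c * perturbed_resolvent \<mu> \<alpha> z phi t)"
    using c by (simp add: perturbed_resolvent_phi fun_eq_iff mult_resolvent_def)
  have "mult_resolvent z phi \<in> L2 \<mu>" using decays_mult_resolvent_phi[OF z] decays_L2(1) by blast
  from L2_cmult[OF this, of "1 / ?c"] have "perturbed_resolvent \<mu> \<alpha> z phi \<in> L2 \<mu>"
    using c unfolding perturbed_resolvent_phi[OF c, abs_def] by (simp add: mult_resolvent_def)
  from V_scale[OF this, of ?c] have "AE s in \<nu>. V (mult_resolvent z phi) s = ?c * V (perturbed_resolvent \<mu> \<alpha> z phi) s"
    unfolding eq[symmetric] .
  moreover have "AE s in \<nu>. V (perturbed_resolvent \<mu> \<alpha> z phi) s = 1 / (of_real s - z)"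
    using representation z by (simp add: spectral_representation_def)
  ultimately show ?thesis by eventually_elim simp
qed

text \<open>
  The perturbed and the unperturbed resolvent of \<open>g\<close> differ by a multiple of \<open>1 / (t - z)\<close>, whose image
  carries the factor \<open>1 + \<alpha> * borel_fun \<mu> z\<close>; it cancels the denominator of the rank one term.
\<close>

lemma V_mult_resolvent:
  assumes z: "z \<notin> \<real>" and g: "decays C g"
  shows "AE s in \<nu>. V (mult_resolvent z g) s
    = (V g s + of_real \<alpha> * L2_inner \<mu> (mult_resolvent z g) phi) / (of_real s - z)"
proof -
  let ?c = "1 + of_real \<alpha> * borel_fun \<mu> z"
  let ?d = "of_real \<alpha> * L2_inner \<mu> (mult_resolvent z g) phi"
  let ?r = "mult_resolvent z phi"
  let ?h = "perturbed_resolvent \<mu> \<alpha> z g"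
  have c: "?c \<noteq> 0" by (rule one_plus_borel_fun_nonzero[OF z])
  have r: "?r \<in> L2 \<mu>" using decays_mult_resolvent_phi[OF z] decays_L2(1) by blast
  have rg: "mult_resolvent z g \<in> L2 \<mu>" using decays_mult_resolvent[OF z] g decays_L2(1) by blast
  have h_eq: "?h = (\<lambda>t. mult_resolvent z g t + (- (?d / ?c)) * ?r t)"
    by (simp add: perturbed_resolvent_def fun_eq_iff)
  have h: "?h \<in> L2 \<mu>" unfolding h_eq by (intro L2_add rg L2_cmult r)
  have eq: "mult_resolvent z g = (\<lambda>t. ?h t + ?d / ?c * ?r t)"
    by (simp add: perturbed_resolvent_def fun_eq_iff)
  have "AE s in \<nu>. V (\<lambda>t. ?h t + ?d / ?c * ?r t) s = V ?h s + V (\<lambda>t. ?d / ?c * ?r t) s"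
    by (rule V_add[OF h L2_cmult[OF r]])
  then have "AE s in \<nu>. V (mult_resolvent z g) s = V ?h s + V (\<lambda>t. ?d / ?c * ?r t) s"
    unfolding eq[symmetric] .
  with V_scale[OF r, of "?d / ?c"] V_resolvent[OF z] V_perturbed_resolvent[OF z decays_L2(1)[OF g] h]
  show ?thesis
  proof eventually_elim
    case (elim s)
    have "d / c * (c / w) = d / w" if "c \<noteq> 0" for c d w :: complex using that by simp
    from this[OF c] show ?case by (simp only: elim add_divide_distrib[of "V g s"])
  qed
qed

lemma V_resolvent_polynomial:
  assumes "resolvent_polynomial g"
  shows "AE s in \<nu>. V g s = difference_transform \<alpha> g s"
  using assms
proof induction
  case (resolvent z)
  then show ?case using V_resolvent[of z] by (simp add: difference_transform_resolvent)
next
  case (mult z g)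
  obtain C where C: "decays C g" using resolvent_polynomial_decays[OF mult.hyps(2)] by blast
  show ?case using V_mult_resolvent[OF mult.hyps(1) C] mult.IH
    by eventually_elim (simp add: difference_transform_mult_resolvent[OF mult.hyps(1) C])
next
  case (add g h)
  obtain C where C: "decays C g" using resolvent_polynomial_decays[OF add.hyps(1)] by blast
  obtain D where D: "decays D h" using resolvent_polynomial_decays[OF add.hyps(2)] by blast
  show ?case using V_add[OF decays_L2(1)[OF C] decays_L2(1)[OF D]] add.IH
    by eventually_elim (simp add: difference_transform_add[OF C D])
next
  case (scale g c)
  obtain C where C: "decays C g" using resolvent_polynomial_decays[OF scale.hyps] by blast
  show ?case using V_scale[OF decays_L2(1)[OF C], of c] scale.IH
    by eventually_elim (simp add: difference_transform_scale[OF C])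
qed

text \<open>
  The images tend to zero only in the mean, so almost everywhere convergence requires a
  subsequence.
\<close>

lemma V_null_sequence:
  assumes d: "\<And>n. decays (1 / real (Suc n)) (d n)"
  shows "\<exists>r. strict_mono r \<and> (AE s in \<nu>. (\<lambda>n. V (d (r n)) s) \<longlonglongrightarrow> 0)"
proof -
  define u where "u = (\<lambda>n s. (cmod (V (d n) s))\<^sup>2)"
  have "integrable \<nu> (u n)" for n
    using V_L2[OF decays_L2(1)[OF d[of n]]] by (simp add: L2_def u_def)
  moreover have "(\<lambda>n. LINT s|\<nu>. norm (u n s)) \<longlonglongrightarrow> 0"
  proof (rule tendsto_sandwich[OF _ _ tendsto_const])
    show "eventually (\<lambda>n. 0 \<le> (LINT s|\<nu>. norm (u n s))) sequentially" by simp
    have "(LINT s|\<nu>. norm (u n s)) \<le> (1 / real (Suc n))\<^sup>2 * total_weight" for n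
      using decays_L2(2)[OF d[of n]] V_norm[OF decays_L2(1)[OF d[of n]]] by (simp add: u_def)
    then show "eventually (\<lambda>n. (LINT s|\<nu>. norm (u n s)) \<le> (1 / real (Suc n))\<^sup>2 * total_weight) sequentially"
      by simp
    have "(\<lambda>n. (1 / real (Suc n))\<^sup>2 * total_weight) \<longlonglongrightarrow> 0\<^sup>2 * total_weight"
      by (intro tendsto_intros LIMSEQ_Suc[OF lim_1_over_n])
    then show "(\<lambda>n. (1 / real (Suc n))\<^sup>2 * total_weight) \<longlonglongrightarrow> 0" by simp
  qed
  ultimately obtain r where r: "strict_mono r" "AE s in \<nu>. (\<lambda>n. u (r n) s) \<longlonglongrightarrow> 0"
    using tendsto_L1_AE_subseq[of \<nu> u] by blast
  from r(2) have "AE s in \<nu>. (\<lambda>n. V (d (r n)) s) \<longlonglongrightarrow> 0"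
  proof eventually_elim
    case (elim s)
    then have "(\<lambda>n. sqrt (u (r n) s)) \<longlonglongrightarrow> sqrt 0" by (rule tendsto_real_sqrt)
    then show ?case by (simp add: u_def tendsto_norm_zero_iff)
  qed
  with r(1) show ?thesis by blast
qed

lemma difference_transform_null_sequence:
  assumes d: "\<And>n. decays (1 / real (Suc n)) (d n)"
  shows "(\<lambda>n. difference_transform a (d n) s) \<longlonglongrightarrow> 0"
proof (rule Lim_null_comparison)
  let ?b = "\<lambda>e. e + \<bar>a\<bar> * (2 * e * (2 + \<bar>s\<bar>) * total_weight)"
  have "cmod (difference_transform a (d n) s) \<le> ?b (1 / real (Suc n))" for n
  proof -
    have "cmod (difference_transform a (d n) s)
        \<le> cmod (d n s) + \<bar>a\<bar> * cmod (LINT t|\<mu>. diff_quot (d n) s t)"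
      unfolding difference_transform_def
      using norm_triangle_ineq4[of "d n s" "of_real a * (LINT t|\<mu>. diff_quot (d n) s t)"]
      by (simp add: norm_mult)
    also have "\<dots> \<le> ?b (1 / real (Suc n))"
      by (intro add_mono mult_left_mono bounded_of_decays[OF d] integrable_diff_quot(2)[OF d]) simp
    finally show ?thesis .
  qed
  then show "eventually (\<lambda>n. cmod (difference_transform a (d n) s) \<le> ?b (1 / real (Suc n))) sequentially"
    by simp
  have "(\<lambda>n. ?b (1 / real (Suc n))) \<longlonglongrightarrow> ?b 0"
    by (intro tendsto_intros LIMSEQ_Suc[OF lim_1_over_n])
  then show "(\<lambda>n. ?b (1 / real (Suc n))) \<longlonglongrightarrow> 0" by simp
qed

text \<open>
  The discrepancy between \<open>V f\<close> and the transform of \<open>f\<close> equals that of the error \<open>f - g\<close> for every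
  approximating \<open>g\<close> in the algebra, and along a suitable sequence the latter tends to zero.
\<close>

theorem V_eq_difference_transform:
  assumes "f C1_differentiable_on UNIV" "compact (closure {x. f x \<noteq> 0})"
  shows "AE s in \<nu>. integrable \<mu> (diff_quot f s) \<and> V f s = difference_transform \<alpha> f s"
proof -
  have "\<exists>g. resolvent_polynomial g \<and> decays (1 / real (Suc n)) (\<lambda>t. f t - g t)" for n
    using resolvent_polynomial_dense[OF assms, of "1 / real (Suc n)"] by simp
  then obtain g where g: "\<And>n. resolvent_polynomial (g n)"
    and close: "\<And>n. decays (1 / real (Suc n)) (\<lambda>t. f t - g n t)" by metis
  define d where "d = (\<lambda>n t. f t - g n t)"
  have d: "decays (1 / real (Suc n)) (d n)" for n using close[of n] by (simp only: d_def)
  have f_eq: "f = (\<lambda>t. g n t + d n t)" for n by (simp add: d_def fun_eq_iff)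
  obtain C where C: "\<And>n. decays (C n) (g n)" using resolvent_polynomial_decays[OF g] by metis
  have f_decays: "decays (C 0 + 1 / real (Suc 0)) f"
    using decays_add[OF C[of 0] d[of 0]] unfolding f_eq[of 0, symmetric] .
  have "AE s in \<nu>. V f s - difference_transform \<alpha> f s = V (d n) s - difference_transform \<alpha> (d n) s" for n
  proof -
    have T: "difference_transform \<alpha> f s = difference_transform \<alpha> (g n) s + difference_transform \<alpha> (d n) s" for s
      using difference_transform_add[OF C[of n] d[of n]] unfolding f_eq[of n, symmetric] .
    have "AE s in \<nu>. V f s = V (g n) s + V (d n) s"
      using V_add[OF decays_L2(1)[OF C[of n]] decays_L2(1)[OF d[of n]]] unfolding f_eq[of n, symmetric] .
    with V_resolvent_polynomial[OF g[of n]] show ?thesis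
      by eventually_elim (simp add: T)
  qed
  then have all: "AE s in \<nu>. \<forall>n. V f s - difference_transform \<alpha> f s = V (d n) s - difference_transform \<alpha> (d n) s"
    by (simp add: AE_all_countable)
  obtain r where r: "strict_mono r" "AE s in \<nu>. (\<lambda>n. V (d (r n)) s) \<longlonglongrightarrow> 0"
    using V_null_sequence[OF d] by blast
  from all r(2) show ?thesis
  proof eventually_elim
    case (elim s)
    have "(\<lambda>n. difference_transform \<alpha> (d (r n)) s) \<longlonglongrightarrow> 0"
      using LIMSEQ_subseq_LIMSEQ[OF difference_transform_null_sequence[OF d] r(1)] by (simp add: o_def)
    from tendsto_diff[OF elim(2) this]
    have "(\<lambda>n. V f s - difference_transform \<alpha> f s) \<longlonglongrightarrow> 0" using elim(1) by simp
    then have "V f s - difference_transform \<alpha> f s = 0" by (simp add: LIMSEQ_const_iff)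
    then show ?case using integrable_diff_quot(1)[OF f_decays] by simp
  qed
qed

end

theorem theorem2p1:
  fixes \<mu> \<mu>\<^sub>\<alpha> :: "real measure"
    and \<alpha> :: real
    and A\<^sub>\<alpha> :: "((real \<Rightarrow> complex) \<times> (real \<Rightarrow> complex)) set"
    and V\<^sub>\<alpha> :: "(real \<Rightarrow> complex) \<Rightarrow> (real \<Rightarrow> complex)"
    and f :: "real \<Rightarrow> complex"
  assumes "sets \<mu> = sets borel"
    and "(\<integral>\<^sup>+ t. ennreal (1 / (1 + \<bar>t\<bar>)) \<partial>\<mu>) < \<infinity>"
    and "rank_one_perturbation \<mu> \<alpha> A\<^sub>\<alpha>"
    and "spectral_measure \<mu> \<alpha> \<mu>\<^sub>\<alpha>"
    and "spectral_representation \<mu> \<alpha> A\<^sub>\<alpha> \<mu>\<^sub>\<alpha> V\<^sub>\<alpha>"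
    and "f C1_differentiable_on UNIV"
    and "compact (closure {x. f x \<noteq> 0})"
  shows "AE s in \<mu>\<^sub>\<alpha>.
           integrable \<mu> (diff_quot f s) \<and>
           V\<^sub>\<alpha> f s = f s - of_real \<alpha> * (LINT t|\<mu>. diff_quot f s t)"
proof -
  interpret rank_one_spectral_representation \<mu> \<mu>\<^sub>\<alpha> \<alpha> A\<^sub>\<alpha> V\<^sub>\<alpha>
    using assms(1-3,5) by unfold_locales
  show ?thesis
    using V_eq_difference_transform[OF assms(6,7)] by (simp add: difference_transform_def)
qed

end
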